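(* Let $G_F$ be the $(3+1)$-dimensional dipole (fracton) group, with dual Lie algebra $\mathfrak{g}_F^*$ having elements written $(\boldsymbol{j},\boldsymbol{d},\boldsymbol{p},q,E)$ (angular momentum, dipole moment, momentum, charge, energy). The energy $E$ is constant on coadjoint orbits, and for each fixed value $E=E_0\in\mathbb{R}$ every coadjoint orbit of $G_F$ is exactly one of the following subsets of $\{E=E_0\}\subset\mathfrak{g}_F^*$, each of which (for each allowed choice of parameters) is a single coadjoint orbit of the stated dimension: (1) ($e\neq0$) $q=e$, $e\boldsymbol{j}+\boldsymbol{p}\times\boldsymbol{d}=\boldsymbol{0}$; dimension $6$. (2) ($e\neq0$, $S>0$) $q=e$, $\|\boldsymbol{j}+e^{-1}\boldsymbol{p}\times\boldsymbol{d}\|=S$; dimension $8$. (3) $q=0$, $\boldsymbol{p}=\boldsymbol{d}=\boldsymbol{j}=\boldsymbol{0}$; dimension $0$. (4) ($j>0$) $q=0$, $\boldsymbol{p}=\boldsymbol{d}=\boldsymbol{0}$, $\|\boldsymbol{j}\|=j$; dimension $2$. (5) ($d>0$, $h\in\mathbb{R}$) $q=0$, $\boldsymbol{p}=\boldsymbol{0}$, $\|\boldsymbol{d}\|=d$, $\boldsymbol{j}\cdot\boldsymbol{d}=h\|\boldsymbol{d}\|$; dimension $4$. (6) ($p>0$, $h\in\mathbb{R}$) $q=0$, $\boldsymbol{d}=\boldsymbol{0}$, $\|\boldsymbol{p}\|=p$, $\boldsymbol{j}\cdot\boldsymbol{p}=h\|\boldsymbol{p}\|$; dimension $4$. ($7_\pm$)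 ($p>0$, $d>0$, $h\in\mathbb{R}$, a sign $\pm$) $q=0$, $\|\boldsymbol{p}\|=p$, $\|\boldsymbol{d}\|=d$, $\boldsymbol{p}\cdot\boldsymbol{d}=\pm pd$, $\boldsymbol{j}\cdot\boldsymbol{p}=h\|\boldsymbol{p}\|$; dimension $4$. (8) ($p>0$, $d>0$, $\theta\in(0,\pi)$) $q=0$, $\|\boldsymbol{p}\|=p$, $\|\boldsymbol{d}\|=d$, $\boldsymbol{p}\cdot\boldsymbol{d}=pd\cos\theta$; dimension $6$.
   Context: The dipole algebra $\mathfrak{g}_F$ (in three spatial dimensions) is the $11$-dimensional real Lie algebra with basis $J_i,D_i,P_i$ ($i=1,2,3$), $Q$, $H_F$ and nonzero brackets $[J_i,J_j]=\epsilon_{ijk}J_k$, $[J_i,D_j]=\epsilon_{ijk}D_k$, $[J_i,P_j]=\epsilon_{ijk}P_k$, $[D_i,P_j]=\delta_{ij}Q$; the elements $Q$ and $H_F$ are central. The dipole group $G_F$ is the connected Lie group with elements $(R,\boldsymbol{v},\boldsymbol{a},\lambda,s)$, $R\in\mathrm{SO}(3)$ (rotations), $\boldsymbol{v}\in\mathbb{R}^3$ (dipole transformations), $\boldsymbol{a}\in\mathbb{R}^3$ (spatial translations), $\lambda$ (charge transformations generated by $Q$), $s$ (time translations generated by $H_F$), with Lie algebra $\mathfrak{g}_F$. An element $\alpha\in\mathfrak{g}_F^*$ is written $(\boldsymbol{j},\boldsymbol{d},\boldsymbol{p},q,E)$, its values on $J_i,D_i,P_i,Q,H_F$ respectively. The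 coadjoint action of $(R,\boldsymbol{v},\boldsymbol{a},\lambda,s)$ is $(\boldsymbol{j},\boldsymbol{d},\boldsymbol{p},q,E)\mapsto(\boldsymbol{j}',\boldsymbol{d}',\boldsymbol{p}',q',E')$ with $$\boldsymbol{j}'=R\boldsymbol{j}+\boldsymbol{v}\times R\boldsymbol{d}+\boldsymbol{a}\times R\boldsymbol{p}+q\,\boldsymbol{v}\times\boldsymbol{a},\quad \boldsymbol{d}'=R\boldsymbol{d}+q\boldsymbol{a},\quad \boldsymbol{p}'=R\boldsymbol{p}-q\boldsymbol{v},\quad q'=q,\quad E'=E$$ (whether the central subgroup generated by $Q$ is $\mathbb{R}$ or $\mathrm{U}(1)$ is immaterial, since it acts trivially). *)

theory Defs
  imports "HOL-Analysis.Analysis" "HOL-Algebra.Group_Action"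
begin

unbundle cross3_syntax

section \<open>The dipole group and its coadjoint action\<close>

text \<open>
  A group element is \<open>(R, v, a, \<lambda>, s)\<close> with \<open>R \<in> SO(3)\<close>; it stands for
  \<open>exp (s H\<^sub>F + \<lambda> Q) exp (a \<cdot> P) exp (v \<cdot> D) R\<close>. Since \<open>[D\<^sub>i, P\<^sub>j] = \<delta>\<^sub>i\<^sub>j Q\<close> with \<open>Q\<close> central,
  moving \<open>exp (v \<cdot> D)\<close> past \<open>exp (a \<cdot> P)\<close> produces \<open>exp ((v \<cdot> a) Q)\<close>, which is the cocycle in the
  multiplication below. The subgroup generated by \<open>Q\<close> is taken to be the real line.
\<close>

type_synonym dipole_element = "(real^3^3) \<times> (real^3) \<times> (real^3) \<times> real \<times> real"

definition dipole_group :: "dipole_element monoid" where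
  "dipole_group =
    \<lparr>carrier = {(R, v, a, l, s). rotation_matrix R},
     mult = (\<lambda>(R, v, a, l, s) (R', v', a', l', s').
       (R ** R', v + R *v v', a + R *v a', l + l' + v \<bullet> (R *v a'), s + s')),
     one = (mat 1, 0, 0, 0, 0)\<rparr>"

text \<open>
  An element \<open>(j, d, p, q, E)\<close> of the dual Lie algebra is given by its values on the basis
  \<open>J\<^sub>i, D\<^sub>i, P\<^sub>i, Q, H\<^sub>F\<close>.
\<close>

type_synonym dipole_dual = "(real^3) \<times> (real^3) \<times> (real^3) \<times> real \<times> real"

definition coadjoint :: "dipole_element \<Rightarrow> dipole_dual \<Rightarrow> dipole_dual" where
  "coadjoint = (\<lambda>(R, v, a, l, s) (j, d, p, q, E).
     (R *v j + v \<times> (R *v d) + a \<times> (R *v p) + q *\<^sub>R (v \<times> a),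
      R *v d + q *\<^sub>R a,
      R *v p - q *\<^sub>R v,
      q,
      E))"

definition energy :: "dipole_dual \<Rightarrow> real" where
  "energy = (\<lambda>(j, d, p, q, E). E)"

abbreviation coadjoint_orbits :: "dipole_dual set set" where
  "coadjoint_orbits \<equiv> orbits dipole_group UNIV coadjoint"

lemma rotation_matrix_mat_1: "rotation_matrix (mat 1 :: real^3^3)"
  by (simp add: rotation_matrix_def orthogonal_matrix_id)

lemma rotation_matrix_mult:
  "rotation_matrix A \<Longrightarrow> rotation_matrix B \<Longrightarrow> rotation_matrix (A ** B)"
  for A B :: "real^3^3"
  by (simp add: rotation_matrix_def orthogonal_matrix_mul det_mul)

lemma rotation_matrix_transpose:
  "rotation_matrix A \<Longrightarrow> rotation_matrix (transpose A)" for A :: "real^3^3"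
  by (simp add: rotation_matrix_def)

lemma rotation_matrix_inner:
  "rotation_matrix A \<Longrightarrow> (A *v x) \<bullet> (A *v y) = x \<bullet> y" for A :: "real^3^3"
  using orthogonal_transformation_matrix[of "(*v) A"]
  by (simp add: rotation_matrix_def orthogonal_transformation_def)

lemma group_dipole_group: "group dipole_group"
proof (rule groupI)
  fix x assume "x \<in> carrier dipole_group"
  then obtain R v a l s where x: "x = (R, v, a, l, s)" and R: "rotation_matrix R"
    by (auto simp: dipole_group_def)
  have RR: "transpose R ** R = mat 1"
    using R by (simp add: rotation_matrix_def orthogonal_matrix)
  let ?y = "(transpose R, - (transpose R *v v), - (transpose R *v a),
             - l + (transpose R *v v) \<bullet> (transpose R *v a), - s)"
  have "?y \<in> carrier dipole_group" "?y \<otimes>\<^bsub>dipole_group\<^esub> x = \<one>\<^bsub>dipole_group\<^esub>"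
    using R by (auto simp: dipole_group_def x RR rotation_matrix_transpose)
  then show "\<exists>y\<in>carrier dipole_group. y \<otimes>\<^bsub>dipole_group\<^esub> x = \<one>\<^bsub>dipole_group\<^esub>"
    by blast
next
  fix x y z
  assume "x \<in> carrier dipole_group" "y \<in> carrier dipole_group" "z \<in> carrier dipole_group"
  then show "x \<otimes>\<^bsub>dipole_group\<^esub> y \<otimes>\<^bsub>dipole_group\<^esub> z = x \<otimes>\<^bsub>dipole_group\<^esub> (y \<otimes>\<^bsub>dipole_group\<^esub> z)"
    by (auto simp: dipole_group_def matrix_mul_assoc matrix_vector_right_distrib
        matrix_vector_mul_assoc[symmetric] rotation_matrix_inner inner_add_left inner_add_right)
qed (auto simp: dipole_group_def rotation_matrix_mat_1 rotation_matrix_mult)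

lemma coadjoint_one: "coadjoint \<one>\<^bsub>dipole_group\<^esub> \<alpha> = \<alpha>"
  by (cases \<alpha>) (simp add: dipole_group_def coadjoint_def)

lemma coadjoint_mult:
  assumes "g \<in> carrier dipole_group" "h \<in> carrier dipole_group"
  shows "coadjoint (g \<otimes>\<^bsub>dipole_group\<^esub> h) \<alpha> = coadjoint g (coadjoint h \<alpha>)"
proof -
  obtain R v a l s where g: "g = (R, v, a, l, s)" and R: "rotation_matrix R"
    using assms(1) by (auto simp: dipole_group_def)
  obtain R' v' a' l' s' where h: "h = (R', v', a', l', s')"
    by (cases h)
  obtain j d p q E where \<alpha>: "\<alpha> = (j, d, p, q, E)"
    by (cases \<alpha>)
  have "\<And>x y. R *v (x \<times> y) = (R *v x) \<times> (R *v y)"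
    using cross_rotation_matrix[OF R] by simp
  moreover have "(R *v v') \<times> a = - (a \<times> (R *v v'))"
    by (rule cross_skew)
  ultimately show ?thesis
    by (simp add: g h \<alpha> dipole_group_def coadjoint_def matrix_vector_right_distrib
        matrix_vector_mult_diff_distrib matrix_vector_mul_assoc[symmetric]
        matrix_vector_mult_scaleR cross_add_left cross_add_right
        cross_mult_left cross_mult_right scaleR_add_right scaleR_diff_right
        Cross3.right_diff_distrib)
qed

lemma group_action_coadjoint: "group_action dipole_group UNIV coadjoint"
proof -
  interpret group dipole_group by (rule group_dipole_group)
  have bij: "bij (coadjoint g)" if g: "g \<in> carrier dipole_group" for g
  proof (rule o_bij)
    show "coadjoint (inv\<^bsub>dipole_group\<^esub> g) \<circ> coadjoint g = id"
      using g by (auto simp: fun_eq_iff coadjoint_mult[symmetric] coadjoint_one)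
    show "coadjoint g \<circ> coadjoint (inv\<^bsub>dipole_group\<^esub> g) = id"
      using g by (auto simp: fun_eq_iff coadjoint_mult[symmetric] coadjoint_one)
  qed
  have "coadjoint \<in> hom dipole_group (BijGroup UNIV)"
    using bij by (auto simp: hom_def BijGroup_def Bij_def compose_def fun_eq_iff coadjoint_mult)
  then show ?thesis
    unfolding group_action_def group_hom_def group_hom_axioms_def
    by (simp add: group_BijGroup group_dipole_group)
qed


section \<open>Dimension of a subset of a Euclidean space\<close>

text \<open>
  \<open>Ck_on k f S\<close>: on the open set \<open>S\<close> the function \<open>f\<close> has continuous iterated directional
  derivatives up to order \<open>k\<close>.
\<close>

primrec Ck_on ::
    "nat \<Rightarrow> ('a::euclidean_space \<Rightarrow> 'b::euclidean_space) \<Rightarrow> 'a set \<Rightarrow> bool" where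
  "Ck_on 0 f S \<longleftrightarrow> continuous_on S f"
| "Ck_on (Suc k) f S \<longleftrightarrow>
     (\<forall>x\<in>S. f differentiable (at x)) \<and> (\<forall>v. Ck_on k (\<lambda>x. frechet_derivative f (at x) v) S)"

definition smooth_on ::
    "('a::euclidean_space \<Rightarrow> 'b::euclidean_space) \<Rightarrow> 'a set \<Rightarrow> bool" where
  "smooth_on f S \<longleftrightarrow> (\<forall>k. Ck_on k f S)"

text \<open>
  \<open>M\<close> is an embedded smooth submanifold of dimension \<open>k\<close>, in the sense of slice charts: near each of
  its points a diffeomorphism between open sets straightens \<open>M\<close> to a \<open>k\<close>-dimensional subspace.
\<close>

definition embedded_submanifold :: "nat \<Rightarrow> 'a::euclidean_space set \<Rightarrow> bool" where
  "embedded_submanifold k M \<longleftrightarrow>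
     (\<forall>x\<in>M. \<exists>(U :: 'a set) (V :: 'a set) (\<Phi> :: 'a \<Rightarrow> 'a) (\<Psi> :: 'a \<Rightarrow> 'a) (W :: 'a set).
        x \<in> U \<and> open U \<and> open V \<and>
        homeomorphism U V \<Phi> \<Psi> \<and> smooth_on \<Phi> U \<and> smooth_on \<Psi> V \<and>
        subspace W \<and> dim W = k \<and> \<Phi> ` (U \<inter> M) = V \<inter> W)"


section \<open>The list of orbits\<close>

text \<open>
  In \<open>Collinear\<close> the first argument is the sign \<open>\<plusminus>\<close>, encoded as \<open>1\<close> or \<open>-1\<close>.
\<close>

datatype orbit_label =
    Charged real
  | Charged_Spin real real
  | Vacuum
  | Spin real
  | Dipole real real
  | Momentum real real
  | Collinear real real real real
  | Generic real real real

fun admissible :: "orbit_label \<Rightarrow> bool" where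
  "admissible (Charged e) \<longleftrightarrow> e \<noteq> 0"
| "admissible (Charged_Spin e S) \<longleftrightarrow> e \<noteq> 0 \<and> S > 0"
| "admissible Vacuum \<longleftrightarrow> True"
| "admissible (Spin j0) \<longleftrightarrow> j0 > 0"
| "admissible (Dipole d0 h) \<longleftrightarrow> d0 > 0"
| "admissible (Momentum p0 h) \<longleftrightarrow> p0 > 0"
| "admissible (Collinear \<sigma> p0 d0 h) \<longleftrightarrow> (\<sigma> = 1 \<or> \<sigma> = -1) \<and> p0 > 0 \<and> d0 > 0"
| "admissible (Generic p0 d0 \<theta>) \<longleftrightarrow> p0 > 0 \<and> d0 > 0 \<and> 0 < \<theta> \<and> \<theta> < pi"

fun orbit_equations :: "orbit_label \<Rightarrow> real^3 \<Rightarrow> real^3 \<Rightarrow> real^3 \<Rightarrow> real \<Rightarrow> bool" where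
  "orbit_equations (Charged e) j d p q \<longleftrightarrow> q = e \<and> e *\<^sub>R j + p \<times> d = 0"
| "orbit_equations (Charged_Spin e S) j d p q \<longleftrightarrow>
     q = e \<and> norm (j + inverse e *\<^sub>R (p \<times> d)) = S"
| "orbit_equations Vacuum j d p q \<longleftrightarrow> q = 0 \<and> p = 0 \<and> d = 0 \<and> j = 0"
| "orbit_equations (Spin j0) j d p q \<longleftrightarrow> q = 0 \<and> p = 0 \<and> d = 0 \<and> norm j = j0"
| "orbit_equations (Dipole d0 h) j d p q \<longleftrightarrow>
     q = 0 \<and> p = 0 \<and> norm d = d0 \<and> j \<bullet> d = h * norm d"
| "orbit_equations (Momentum p0 h) j d p q \<longleftrightarrow>
     q = 0 \<and> d = 0 \<and> norm p = p0 \<and> j \<bullet> p = h * norm p"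
| "orbit_equations (Collinear \<sigma> p0 d0 h) j d p q \<longleftrightarrow>
     q = 0 \<and> norm p = p0 \<and> norm d = d0 \<and> p \<bullet> d = \<sigma> * (p0 * d0) \<and> j \<bullet> p = h * norm p"
| "orbit_equations (Generic p0 d0 \<theta>) j d p q \<longleftrightarrow>
     q = 0 \<and> norm p = p0 \<and> norm d = d0 \<and> p \<bullet> d = p0 * d0 * cos \<theta>"

definition orbit_set :: "real \<Rightarrow> orbit_label \<Rightarrow> dipole_dual set" where
  "orbit_set E\<^sub>0 c = {(j, d, p, q, E). E = E\<^sub>0 \<and> orbit_equations c j d p q}"

fun orbit_dim :: "orbit_label \<Rightarrow> nat" where
  "orbit_dim (Charged e) = 6"
| "orbit_dim (Charged_Spin e S) = 8"
| "orbit_dim Vacuum = 0"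
| "orbit_dim (Spin j0) = 2"
| "orbit_dim (Dipole d0 h) = 4"
| "orbit_dim (Momentum p0 h) = 4"
| "orbit_dim (Collinear \<sigma> p0 d0 h) = 4"
| "orbit_dim (Generic p0 d0 \<theta>) = 6"

end

theory Submission
  imports Defs
begin

text \<open>
  For \<open>q \<noteq> 0\<close> the pair \<open>(d, p)\<close> can be moved to any prescribed value, and \<open>q j + p \<times> d\<close> only gets rotated,
  so its norm is a complete invariant. For \<open>q = 0\<close> both \<open>d\<close> and \<open>p\<close> only get rotated, while \<open>j\<close> is
  translated by all of \<open>d\<^sup>\<bottom> + p\<^sup>\<bottom>\<close>; this is a plane if \<open>d\<close> and \<open>p\<close> are parallel and not both zero,
  and all of space if they are independent.

  Every orbit is carried by an explicit local diffeomorphism to a product of points, spheres, circles,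
  hyperplanes and Euclidean spaces. For \<open>q \<noteq> 0\<close> it is \<open>j \<mapsto> j + q\<^sup>-\<^sup>1 p \<times> d\<close>. For \<open>q = 0\<close> one first replaces
  \<open>d\<close> by its component orthogonal to \<open>p\<close> (exchanging \<open>d\<close> and \<open>p\<close> if \<open>p = 0\<close>), and then trivialises the tangent planes of the sphere of
  momenta near a point by the half turn exchanging \<open>p\<close> with a fixed direction. A sphere is straightened by
  replacing one Cartesian coordinate by the squared radius. All charts and their inverses are built from
  polynomials, reciprocals and square roots.
\<close>

section \<open>Smooth functions\<close>

lemma Ck_on_cong:
  assumes "open S" "\<And>x. x \<in> S \<Longrightarrow> f x = g x" "Ck_on k f S"
  shows "Ck_on k g S"
  using assms(2,3)
proof (induction k arbitrary: f g)
  case 0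
  then show ?case by (simp cong: continuous_on_cong)
next
  case (Suc k)
  have g: "(g has_derivative frechet_derivative f (at x)) (at x)" if "x \<in> S" for x
    by (rule has_derivative_transform_within_open[OF _ assms(1) that Suc.prems(1)])
      (use Suc.prems that in \<open>auto simp: frechet_derivative_works\<close>)
  have g': "frechet_derivative g (at x) = frechet_derivative f (at x)" if "x \<in> S" for x
    using frechet_derivative_at[OF g[OF that]] by simp
  have "Ck_on k (\<lambda>x. frechet_derivative g (at x) v) S" for v
    by (rule Suc.IH[where f = "\<lambda>x. frechet_derivative f (at x) v"]) (use g' Suc.prems in auto)
  with g show ?case
    by (auto simp: differentiable_def)
qed

text \<open>Uniqueness of the derivative lets an explicit formula \<open>f'\<close> stand in for the
  choice term \<open>frechet_derivative\<close>; the inductions on the order below rest on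
  this.\<close>

lemma Ck_on_SucI:
  assumes "open S" "\<And>x. x \<in> S \<Longrightarrow> (f has_derivative f' x) (at x)"
    and "\<And>v. Ck_on k (\<lambda>x. f' x v) S"
  shows "Ck_on (Suc k) f S"
proof -
  have f': "f' x = frechet_derivative f (at x)" if "x \<in> S" for x
    using frechet_derivative_at[OF assms(2)[OF that]] .
  have "Ck_on k (\<lambda>x. frechet_derivative f (at x) v) S" for v
    by (rule Ck_on_cong[OF assms(1) _ assms(3)[of v]]) (simp add: f')
  with assms(2) show ?thesis
    by (auto simp: differentiable_def)
qed

lemma Ck_on_SucD:
  assumes "Ck_on (Suc k) f S"
  shows "x \<in> S \<Longrightarrow> (f has_derivative frechet_derivative f (at x)) (at x)"
    and "Ck_on k (\<lambda>x. frechet_derivative f (at x) v) S"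
  using assms by (auto simp: frechet_derivative_works)

lemma Ck_on_lower: "Ck_on (Suc k) f S \<Longrightarrow> Ck_on k f S"
proof (induction k arbitrary: f)
  case 0
  then show ?case
    by (auto intro!: continuous_at_imp_continuous_on differentiable_imp_continuous_within)
next
  case (Suc k)
  then show ?case
    unfolding Ck_on.simps(2)[of "Suc k"] Ck_on.simps(2)[of k] by blast
qed

lemma Ck_on_subset: "Ck_on k f S \<Longrightarrow> T \<subseteq> S \<Longrightarrow> Ck_on k f T"
  by (induction k arbitrary: f) (auto intro: continuous_on_subset)

lemma Ck_on_const:
  assumes "open S"
  shows "Ck_on k (\<lambda>x. c) S"
proof (induction k arbitrary: c)
  case (Suc k)
  show ?case by (rule Ck_on_SucI[OF assms has_derivative_const Suc.IH])
qed simp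

lemma Ck_on_bounded_linear:
  assumes "open S" "bounded_linear L" "Ck_on k f S"
  shows "Ck_on k (\<lambda>x. L (f x)) S"
  using assms(3)
proof (induction k arbitrary: f)
  case 0
  then show ?case using assms(2) by (simp add: bounded_linear.continuous_on)
next
  case (Suc k)
  show ?case
    by (rule Ck_on_SucI[OF assms(1) bounded_linear.has_derivative[OF assms(2) Ck_on_SucD(1)[OF Suc.prems]]])
       (use Suc in auto)
qed

lemma Ck_on_ident:
  assumes "open S"
  shows "Ck_on k (\<lambda>x. x) S"
proof (cases k)
  case (Suc k)
  show ?thesis unfolding Suc
    by (rule Ck_on_SucI[OF assms has_derivative_ident]) (rule Ck_on_const[OF assms])
qed simp

lemma Ck_on_add:
  assumes "open S" "Ck_on k f S" "Ck_on k g S"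
  shows "Ck_on k (\<lambda>x. f x + g x) S"
  using assms(2,3)
proof (induction k arbitrary: f g)
  case 0
  then show ?case by (simp add: continuous_on_add)
next
  case (Suc k)
  show ?case
    by (rule Ck_on_SucI[OF assms(1) has_derivative_add[OF Ck_on_SucD(1)[OF Suc.prems(1)] Ck_on_SucD(1)[OF Suc.prems(2)]]])
       (use Suc in auto)
qed

text \<open>Each summand of the product rule pairs a differentiated factor with an undifferentiated
  one; the latter has one order to spare, hence \<open>Ck_on_lower\<close>.\<close>

lemma Ck_on_bilinear:
  assumes "open S" "bounded_bilinear B" "Ck_on k f S" "Ck_on k g S"
  shows "Ck_on k (\<lambda>x. B (f x) (g x)) S"
  using assms(3,4)
proof (induction k arbitrary: f g)
  case 0
  then show ?case using bounded_bilinear.continuous_on[OF assms(2)] by simp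
next
  case (Suc k)
  note fg = Suc.prems
  show ?case
    by (rule Ck_on_SucI[OF assms(1) bounded_bilinear.FDERIV[OF assms(2) Ck_on_SucD(1)[OF fg(1)] Ck_on_SucD(1)[OF fg(2)]]])
       (auto intro!: Ck_on_add[OF assms(1)] Suc.IH Ck_on_SucD(2)[OF fg(1)] Ck_on_SucD(2)[OF fg(2)]
          Ck_on_lower[OF fg(1)] Ck_on_lower[OF fg(2)])
qed

text \<open>The derivative of the reciprocal is built from the reciprocal itself and a derivative of
  \<open>f\<close>, so its regularity of order \<open>k\<close> bootstraps to order
  \<open>Suc k\<close>.\<close>

lemma Ck_on_inverse:
  fixes f :: "'a::euclidean_space \<Rightarrow> real"
  assumes "open S" "\<And>x. x \<in> S \<Longrightarrow> f x \<noteq> 0" "Ck_on k f S"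
  shows "Ck_on k (\<lambda>x. inverse (f x)) S"
  using assms(3)
proof (induction k)
  case 0
  then show ?case using assms(2) by (simp add: continuous_on_inverse)
next
  case (Suc k)
  have IH: "Ck_on k (\<lambda>x. inverse (f x)) S"
    by (rule Suc.IH[OF Ck_on_lower[OF Suc.prems]])
  have d: "((\<lambda>x. inverse (f x)) has_derivative
      (\<lambda>v. - (inverse (f x) * frechet_derivative f (at x) v * inverse (f x)))) (at x)" if "x \<in> S" for x
    using Deriv.has_derivative_inverse[OF assms(2)[OF that] Ck_on_SucD(1)[OF Suc.prems that]] .
  show ?case
    by (rule Ck_on_SucI[OF assms(1) d], assumption)
       (intro Ck_on_bounded_linear[OF assms(1) bounded_linear_minus[OF bounded_linear_ident]]
         Ck_on_bilinear[OF assms(1) bounded_bilinear_mult] IH Ck_on_SucD(2)[OF Suc.prems])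
qed

text \<open>The same bootstrap: the derivative is that of \<open>f\<close> times half the reciprocal
  of the root.\<close>

lemma Ck_on_sqrt:
  fixes f :: "'a::euclidean_space \<Rightarrow> real"
  assumes "open S" "\<And>x. x \<in> S \<Longrightarrow> f x > 0" "Ck_on k f S"
  shows "Ck_on k (\<lambda>x. sqrt (f x)) S"
  using assms(3)
proof (induction k)
  case 0
  then show ?case by (simp add: continuous_on_real_sqrt)
next
  case (Suc k)
  have "Ck_on k (\<lambda>x. sqrt (f x)) S"
    by (rule Suc.IH[OF Ck_on_lower[OF Suc.prems]])
  then have IH: "Ck_on k (\<lambda>x. inverse (sqrt (f x))) S"
    by (rule Ck_on_inverse[OF assms(1), rotated]) (metis assms(2) less_irrefl real_sqrt_gt_zero)
  have d: "((\<lambda>x. sqrt (f x)) has_derivative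
      (\<lambda>v. frechet_derivative f (at x) v * (inverse (sqrt (f x)) * (1/2)))) (at x)" if "x \<in> S" for x
    using has_derivative_real_sqrt[OF assms(2)[OF that] Ck_on_SucD(1)[OF Suc.prems that]]
    by (simp add: field_simps)
  show ?case
    by (rule Ck_on_SucI[OF assms(1) d], assumption)
       (intro Ck_on_bilinear[OF assms(1) bounded_bilinear_mult] IH Ck_on_SucD(2)[OF Suc.prems]
          Ck_on_const assms(1))
qed

lemma Ck_on_sum:
  assumes "open S" "finite I" "\<And>i. i \<in> I \<Longrightarrow> Ck_on k (f i) S"
  shows "Ck_on k (\<lambda>x. \<Sum>i\<in>I. f i x) S"
  using assms(2,3) by (induction I rule: finite_induct) (simp_all add: Ck_on_const Ck_on_add assms(1))

lemma Ck_on_compose: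
  assumes "open S" "open T" "f ` S \<subseteq> T" "Ck_on k f S" "Ck_on k g T"
  shows "Ck_on k (\<lambda>x. g (f x)) S"
  using assms(3-5)
proof (induction k arbitrary: g)
  case 0
  then show ?case using continuous_on_compose2[of T g S f] by simp
next
  case (Suc k)
  let ?f' = "\<lambda>x. frechet_derivative f (at x)" and ?g' = "\<lambda>y. frechet_derivative g (at y)"
  \<comment> \<open>In the chain rule the direction fed to \<open>?g' (f x)\<close> varies with
    \<open>x\<close>, while \<open>Ck_on\<close> handles fixed directions only. Expanding that
    direction in the basis leaves fixed directions \<open>b\<close>, with scalar coefficients that
    come from the derivative of \<open>f\<close>.\<close>
  have d: "((\<lambda>x. g (f x)) has_derivative (\<lambda>v. \<Sum>b\<in>Basis. (?f' x v \<bullet> b) *\<^sub>R ?g' (f x) b)) (at x)"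
    if x: "x \<in> S" for x
  proof -
    have g: "(g has_derivative ?g' (f x)) (at (f x))"
      using Suc.prems(1) x by (intro Ck_on_SucD(1)[OF Suc.prems(3)]) blast
    have lin: "linear (?g' (f x))"
      using g by (rule has_derivative_linear)
    have g'_basis: "?g' (f x) w = (\<Sum>b\<in>Basis. (w \<bullet> b) *\<^sub>R ?g' (f x) b)" for w
      by (subst (1) euclidean_representation[of w, symmetric])
        (simp only: linear_sum[OF lin] linear_cmul[OF lin])
    show ?thesis
      by (rule has_derivative_eq_rhs[OF has_derivative_compose[OF Ck_on_SucD(1)[OF Suc.prems(2) x] g]])
        (rule ext, rule g'_basis)
  qed
  have g': "Ck_on k (\<lambda>x. ?g' (f x) b) S" for b
    using Suc.IH[OF Suc.prems(1) Ck_on_lower[OF Suc.prems(2)] Ck_on_SucD(2)[OF Suc.prems(3)]] .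
  show ?case
    by (rule Ck_on_SucI[OF assms(1) d], assumption)
       (intro Ck_on_sum g' Ck_on_SucD(2)[OF Suc.prems(2)] assms(1) finite_Basis
         Ck_on_bilinear[OF assms(1) bounded_bilinear_scaleR]
         Ck_on_bounded_linear[OF assms(1) bounded_linear_inner_left])
qed

section \<open>Closure properties of smooth maps\<close>

lemma smooth_on_imp_continuous_on: "smooth_on f S \<Longrightarrow> continuous_on S f"
  unfolding smooth_on_def by (metis Ck_on.simps(1))

lemma smooth_on_subset: "smooth_on f S \<Longrightarrow> T \<subseteq> S \<Longrightarrow> smooth_on f T"
  by (auto simp: smooth_on_def intro: Ck_on_subset)

lemma smooth_on_compose:
  "smooth_on g T \<Longrightarrow> smooth_on f S \<Longrightarrow> open S \<Longrightarrow> open T \<Longrightarrow> f ` S \<subseteq> T \<Longrightarrow> smooth_on (\<lambda>x. g (f x)) S"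
  by (auto simp: smooth_on_def intro: Ck_on_compose)

lemma smooth_on_bounded_linear:
  "bounded_linear L \<Longrightarrow> open S \<Longrightarrow> smooth_on f S \<Longrightarrow> smooth_on (\<lambda>x. L (f x)) S"
  by (auto simp: smooth_on_def intro: Ck_on_bounded_linear)

lemma smooth_on_bilinear:
  "bounded_bilinear B \<Longrightarrow> open S \<Longrightarrow> smooth_on f S \<Longrightarrow> smooth_on g S \<Longrightarrow>
    smooth_on (\<lambda>x. B (f x) (g x)) S"
  by (auto simp: smooth_on_def intro: Ck_on_bilinear)

named_theorems smooth_intros

lemma smooth_on_const [smooth_intros]: "open S \<Longrightarrow> smooth_on (\<lambda>x. c) S"
  by (auto simp: smooth_on_def intro: Ck_on_const)

lemma smooth_on_ident [smooth_intros]: "open S \<Longrightarrow> smooth_on (\<lambda>x. x) S"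
  by (auto simp: smooth_on_def intro: Ck_on_ident)

lemma smooth_on_add [smooth_intros]:
  "open S \<Longrightarrow> smooth_on f S \<Longrightarrow> smooth_on g S \<Longrightarrow> smooth_on (\<lambda>x. f x + g x) S"
  by (auto simp: smooth_on_def intro: Ck_on_add)

lemma smooth_on_diff [smooth_intros]:
  assumes "open S" "smooth_on f S" "smooth_on g S"
  shows "smooth_on (\<lambda>x. f x - g x) S"
  using smooth_on_add[OF assms(1,2)
      smooth_on_bounded_linear[OF bounded_linear_minus[OF bounded_linear_ident] assms(1,3)]]
  by simp

lemmas smooth_on_scaleR [smooth_intros] = smooth_on_bilinear[OF bounded_bilinear_scaleR]
  and smooth_on_mult [smooth_intros] = smooth_on_bilinear[OF bounded_bilinear_mult]
  and smooth_on_inner [smooth_intros] = smooth_on_bilinear[OF bounded_bilinear_inner]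
  and smooth_on_cross [smooth_intros] = smooth_on_bilinear[OF bilinear_conv_bounded_bilinear[THEN iffD1, OF bilinear_cross]]
  and smooth_on_fst [smooth_intros] = smooth_on_bounded_linear[OF bounded_linear_fst]
  and smooth_on_snd [smooth_intros] = smooth_on_bounded_linear[OF bounded_linear_snd]

lemma smooth_on_Pair [smooth_intros]:
  assumes "open S" "smooth_on f S" "smooth_on g S"
  shows "smooth_on (\<lambda>x. (f x, g x)) S"
proof -
  have "smooth_on (\<lambda>x. (f x, 0) + (0, g x)) S"
    using assms bounded_linear_Pair[OF bounded_linear_ident bounded_linear_zero]
      bounded_linear_Pair[OF bounded_linear_zero bounded_linear_ident]
    by (intro smooth_on_add) (auto intro: smooth_on_bounded_linear)
  then show ?thesis by simp
qed

lemma smooth_on_inverse [smooth_intros]: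
  fixes f :: "'a::euclidean_space \<Rightarrow> real"
  shows "open S \<Longrightarrow> smooth_on f S \<Longrightarrow> \<forall>x\<in>S. f x \<noteq> 0 \<Longrightarrow> smooth_on (\<lambda>x. inverse (f x)) S"
  by (auto simp: smooth_on_def intro: Ck_on_inverse)

lemma smooth_on_divide [smooth_intros]:
  fixes f :: "'a::euclidean_space \<Rightarrow> real"
  shows "open S \<Longrightarrow> smooth_on f S \<Longrightarrow> smooth_on g S \<Longrightarrow> \<forall>x\<in>S. g x \<noteq> 0 \<Longrightarrow>
    smooth_on (\<lambda>x. f x / g x) S"
  by (simp add: divide_inverse smooth_intros)

lemma smooth_on_sqrt [smooth_intros]:
  "open S \<Longrightarrow> smooth_on f S \<Longrightarrow> \<forall>x\<in>S. f x > 0 \<Longrightarrow> smooth_on (\<lambda>x. sqrt (f x)) S"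
  by (auto simp: smooth_on_def intro: Ck_on_sqrt)

lemma smooth_on_norm [smooth_intros]:
  "open S \<Longrightarrow> smooth_on f S \<Longrightarrow> \<forall>x\<in>S. f x \<noteq> 0 \<Longrightarrow> smooth_on (\<lambda>x. norm (f x)) S"
  by (simp add: norm_eq_sqrt_inner smooth_intros)

section \<open>Rotations and cross products\<close>

lemma ex_rotation_matrix_axes:
  fixes a b :: "real^3"
  assumes "norm a = 1" "norm b = 1" "a \<bullet> b = 0"
  obtains R where "rotation_matrix R" "R *v a = axis 1 1" "R *v b = axis 2 1"
proof -
  \<comment> \<open>The rows form a positively oriented orthonormal frame; the determinant is their
    triple product.\<close>
  define R :: "real^3^3" where "R = vector [a, b, a \<times> b]"
  have n: "a \<bullet> a = 1" "b \<bullet> b = 1" "b \<bullet> a = 0"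
    using assms by (simp_all add: norm_eq_1 inner_commute)
  have nc: "norm (a \<times> b) = 1"
    using norm_cross_dot[of a b] assms by (simp add: power2_eq_1_iff)
       (metis norm_ge_zero neg_0_le_iff_le not_one_le_zero)
  have "det R = a \<bullet> (b \<times> (a \<times> b))"
    by (simp add: R_def dot_cross_det)
  also have "\<dots> = 1"
    by (simp add: Lagrange inner_diff_right n)
  finally have "det R = 1" .
  moreover have "orthogonal_matrix R"
    using nc assms n
    by (auto simp: orthogonal_matrix_orthonormal_rows R_def row_def vec_lambda_eta
        pairwise_def rows_def forall_3 orthogonal_def dot_cross_self)
  ultimately have "rotation_matrix R" by (simp add: rotation_matrix_def)
  moreover have "R *v a = axis 1 1" "R *v b = axis 2 1"
    using n assms(3)
    by (simp_all add: vec_eq_iff forall_3 R_def matrix_vector_mul_component axis_def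
        inner_commute[of "a \<times> b"] dot_cross_self)
  ultimately show ?thesis by (rule that)
qed

text \<open>Both pairs, once normalised, rotate to the first two axes; one of these rotations is
  followed by the inverse of the other.\<close>

lemma ex_rotation_matrix_pair:
  fixes a b a' b' :: "real^3"
  assumes "norm a = norm a'" "norm b = norm b'" "a \<bullet> b = 0" "a' \<bullet> b' = 0"
    and "a \<noteq> 0" "b \<noteq> 0"
  obtains R where "rotation_matrix R" "R *v a = a'" "R *v b = b'"
proof -
  have nz: "a' \<noteq> 0" "b' \<noteq> 0" using assms by auto
  obtain S where S: "rotation_matrix S" "S *v (a /\<^sub>R norm a) = axis 1 1" "S *v (b /\<^sub>R norm b) = axis 2 1"
    using assms(3,5,6) ex_rotation_matrix_axes[of "a /\<^sub>R norm a" "b /\<^sub>R norm b"] by auto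
  obtain T where T: "rotation_matrix T" "T *v (a' /\<^sub>R norm a') = axis 1 1" "T *v (b' /\<^sub>R norm b') = axis 2 1"
    using assms(4) nz ex_rotation_matrix_axes[of "a' /\<^sub>R norm a'" "b' /\<^sub>R norm b'"] by auto
  have "S *v a = T *v a'" "S *v b = T *v b'"
    using S T assms nz by (simp_all add: matrix_vector_mult_scaleR) (metis scaleR_cancel_left inverse_nonzero_iff_nonzero norm_eq_zero)+
  moreover have "transpose T *v (T *v x) = x" for x
    using T(1) by (simp add: rotation_matrix_def orthogonal_matrix matrix_vector_mul_assoc)
  ultimately have "(transpose T ** S) *v a = a'" "(transpose T ** S) *v b = b'"
    by (simp_all add: matrix_vector_mul_assoc[symmetric])
  then show ?thesis
    using that[of "transpose T ** S"] S(1) T(1)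
    by (simp add: rotation_matrix_mult rotation_matrix_transpose)
qed

lemma ex_rotation_matrix:
  fixes a b :: "real^3"
  assumes "norm a = norm b"
  obtains R where "rotation_matrix R" "R *v a = b"
proof -
  have "2 \<le> CARD(3)" by simp
  from rotation_exists[OF this assms] obtain f where
    f: "orthogonal_transformation f" "det (matrix f) = 1" "f a = b" by blast
  then have "rotation_matrix (matrix f)" "matrix f *v a = b"
    by (simp_all add: rotation_matrix_def orthogonal_transformation_matrix
        orthogonal_transformation_linear matrix_works linear_matrix_vector_mul_eq)
  then show ?thesis by (rule that)
qed

text \<open>Cross products with \<open>p\<close> fill the whole plane orthogonal to
  \<open>p\<close>. The witness comes from the expansion \<open>(p \<times> w) \<times> p = (p
  \<bullet> p) w - (w \<bullet> p) p\<close>.\<close>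

lemma ex_cross_eq:
  fixes w p :: "real^3"
  assumes "p \<noteq> 0" "w \<bullet> p = 0"
  obtains v where "v \<times> p = w"
proof
  show "((1 / (p \<bullet> p)) *\<^sub>R (p \<times> w)) \<times> p = w"
    using assms by (simp add: cross_mult_left cross_triple cross_skew[of "p \<times> w"] Lagrange inner_commute)
qed

text \<open>For independent \<open>d\<close> and \<open>p\<close> the planes orthogonal to them span
  space: the part \<open>z\<close> of \<open>d\<close> orthogonal to \<open>p\<close> lies in the
  second plane but not in the first. So \<open>w\<close> splits into a vector orthogonal to
  \<open>d\<close> and a multiple of \<open>z\<close>.\<close>

lemma ex_cross_add_cross_eq:
  fixes w p d :: "real^3"
  assumes "p \<noteq> 0" "(d - c *\<^sub>R p) \<bullet> p = 0" "d - c *\<^sub>R p \<noteq> 0"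
  obtains v a where "v \<times> d + a \<times> p = w"
proof -
  define z where "z = d - c *\<^sub>R p"
  have d: "d = z + c *\<^sub>R p" by (simp add: z_def)
  have z: "z \<bullet> p = 0" "z \<bullet> z \<noteq> 0" using assms by (simp_all add: z_def)
  have zd: "z \<bullet> d = z \<bullet> z" using z by (simp add: d inner_add_right)
  have "d \<noteq> 0" using zd z by auto
  \<comment> \<open>The coefficient makes \<open>w2 \<bullet> d = w \<bullet> d\<close>, because
    \<open>z \<bullet> d = z \<bullet> z\<close>.\<close>
  define w2 where "w2 = (w \<bullet> d / (z \<bullet> z)) *\<^sub>R z"
  have "(w - w2) \<bullet> d = 0" using z zd by (simp add: w2_def inner_diff_left)
  then obtain v where v: "v \<times> d = w - w2" using ex_cross_eq \<open>d \<noteq> 0\<close> by metis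
  have "w2 \<bullet> p = 0" using z by (simp add: w2_def)
  then obtain a where "a \<times> p = w2" using ex_cross_eq assms(1) by metis
  with v show ?thesis using that[of v a] by simp
qed

section \<open>Slice charts\<close>

definition diffeo ::
    "'a::euclidean_space set \<Rightarrow> 'b::euclidean_space set \<Rightarrow> ('a \<Rightarrow> 'b) \<Rightarrow> ('b \<Rightarrow> 'a) \<Rightarrow> bool" where
  "diffeo U V f g \<longleftrightarrow> open U \<and> open V \<and> f ` U \<subseteq> V \<and> g ` V \<subseteq> U \<and>
     (\<forall>x\<in>U. g (f x) = x) \<and> (\<forall>y\<in>V. f (g y) = y) \<and> smooth_on f U \<and> smooth_on g V"

text \<open>The chart is tested by membership instead of an equation of images, which passes
  directly through composites and products. The point may lie off \<open>M\<close>.\<close>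

definition slice_at :: "nat \<Rightarrow> 'a::euclidean_space set \<Rightarrow> 'a \<Rightarrow> bool" where
  "slice_at k M x \<longleftrightarrow> (\<exists>(U :: 'a set) (V :: 'a set) f g W. x \<in> U \<and> diffeo U V f g \<and>
     subspace W \<and> dim W = k \<and> (\<forall>z\<in>U. z \<in> M \<longleftrightarrow> f z \<in> W))"

lemma slice_atI:
  fixes x :: "'a::euclidean_space" and f g :: "'a \<Rightarrow> 'a"
  assumes "diffeo U V f g" "x \<in> U" "subspace W" "dim W = k" "\<And>z. z \<in> U \<Longrightarrow> z \<in> M \<longleftrightarrow> f z \<in> W"
  shows "slice_at k M x"
  using assms unfolding slice_at_def by blast

lemma embedded_submanifoldI:
  assumes "\<And>x. x \<in> M \<Longrightarrow> slice_at k M x"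
  shows "embedded_submanifold k M"
  unfolding embedded_submanifold_def
proof
  fix x assume "x \<in> M"
  then obtain U V :: "'a set" and f g W where x: "x \<in> U" and d: "diffeo U V f g"
    and W: "subspace W" "dim W = k" and M: "\<forall>z\<in>U. z \<in> M \<longleftrightarrow> f z \<in> W"
    using assms unfolding slice_at_def by blast
  have "homeomorphism U V f g"
    using d unfolding diffeo_def by (auto intro!: homeomorphismI smooth_on_imp_continuous_on)
  moreover have "f ` (U \<inter> M) = V \<inter> W"
  proof
    show "f ` (U \<inter> M) \<subseteq> V \<inter> W"
      using d M by (auto simp: diffeo_def)
    show "V \<inter> W \<subseteq> f ` (U \<inter> M)"
    proof
      fix y assume "y \<in> V \<inter> W"
      then have "g y \<in> U \<inter> M" "f (g y) = y"
        using d M by (auto simp: diffeo_def)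
      then show "y \<in> f ` (U \<inter> M)" by (metis imageI)
    qed
  qed
  ultimately show "\<exists>(U :: 'a set) (V :: 'a set) f g W. x \<in> U \<and> open U \<and> open V \<and>
      homeomorphism U V f g \<and> smooth_on f U \<and> smooth_on g V \<and>
      subspace W \<and> dim W = k \<and> f ` (U \<inter> M) = V \<inter> W"
    using x d[unfolded diffeo_def] W by blast
qed

text \<open>The middle sets \<open>V\<close> and \<open>V'\<close> may differ, so both ends shrink
  to the preimages where the composites are defined; these are open by continuity.\<close>

lemma diffeo_compose:
  assumes "diffeo U V f g" "diffeo V' W f' g'"
  shows "diffeo (U \<inter> f -` V') (W \<inter> g' -` V) (\<lambda>x. f' (f x)) (\<lambda>y. g (g' y))"
proof -
  have o: "open (U \<inter> f -` V')" "open (W \<inter> g' -` V)"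
    using assms by (auto simp: diffeo_def intro!: continuous_open_preimage smooth_on_imp_continuous_on)
  moreover have "smooth_on (\<lambda>x. f' (f x)) (U \<inter> f -` V')"
    using assms o by (intro smooth_on_compose[where g = f' and T = V', OF _ smooth_on_subset[of f U]])
      (auto simp: diffeo_def)
  moreover have "smooth_on (\<lambda>y. g (g' y)) (W \<inter> g' -` V)"
    using assms o by (intro smooth_on_compose[where g = g and T = V, OF _ smooth_on_subset[of g' W]])
      (auto simp: diffeo_def)
  ultimately show ?thesis
    using assms unfolding diffeo_def by (auto simp: image_subset_iff)
qed

lemma smooth_on_fst_compose:
  "open U \<Longrightarrow> smooth_on f U \<Longrightarrow> open S \<Longrightarrow> fst ` S \<subseteq> U \<Longrightarrow> smooth_on (\<lambda>x. f (fst x)) S"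
  by (rule smooth_on_compose[OF _ smooth_on_fst[OF _ smooth_on_ident]])

lemma smooth_on_snd_compose:
  "open U \<Longrightarrow> smooth_on f U \<Longrightarrow> open S \<Longrightarrow> snd ` S \<subseteq> U \<Longrightarrow> smooth_on (\<lambda>x. f (snd x)) S"
  by (rule smooth_on_compose[OF _ smooth_on_snd[OF _ smooth_on_ident]])

unbundle no cross3_syntax

lemma diffeo_Times:
  assumes "diffeo U V f g" "diffeo U' V' f' g'"
  shows "diffeo (U \<times> U') (V \<times> V') (\<lambda>x. (f (fst x), f' (snd x))) (\<lambda>y. (g (fst y), g' (snd y)))"
proof -
  have o: "open (U \<times> U')" "open (V \<times> V')"
    using assms by (auto simp: diffeo_def open_Times)
  have "smooth_on (\<lambda>x. f (fst x)) (U \<times> U')" "smooth_on (\<lambda>x. f' (snd x)) (U \<times> U')"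
    "smooth_on (\<lambda>y. g (fst y)) (V \<times> V')" "smooth_on (\<lambda>y. g' (snd y)) (V \<times> V')"
    using assms o 
    by (auto simp: diffeo_def intro!: smooth_on_fst_compose[of U f] smooth_on_snd_compose[of U' f']
        smooth_on_fst_compose[of V g] smooth_on_snd_compose[of V' g'])
  note smooth_on_Pair[OF o(1) this(1,2)] smooth_on_Pair[OF o(2) this(3,4)]
  with assms o show ?thesis
    unfolding diffeo_def by (auto simp: image_subset_iff)
qed

text \<open>Pulls a slice chart back along \<open>F\<close>; this reduces each orbit, near a given
  point, to a product model.\<close>

lemma slice_at_transfer:
  fixes x :: "'a::euclidean_space" and F G :: "'a \<Rightarrow> 'a"
  assumes "diffeo A B F G" "x \<in> A" "slice_at k N (F x)" "\<And>z. z \<in> A \<Longrightarrow> z \<in> M \<longleftrightarrow> F z \<in> N"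
  shows "slice_at k M x"
proof -
  obtain U V :: "'a set" and f g W where U: "F x \<in> U" "diffeo U V f g" "subspace W" "dim W = k"
      "\<forall>z\<in>U. z \<in> N \<longleftrightarrow> f z \<in> W"
    using assms(3) unfolding slice_at_def by blast
  show ?thesis
    by (rule slice_atI[OF diffeo_compose[OF assms(1) U(2)] _ U(3,4)]) (use U assms(2,4) in auto)
qed

lemma slice_at_Times:
  fixes x :: "'a::euclidean_space" and y :: "'b::euclidean_space"
  assumes "slice_at k M x" "slice_at l N y"
  shows "slice_at (k + l) (M \<times> N) (x, y)"
proof -
  obtain U V :: "'a set" and f g W where U: "x \<in> U" "diffeo U V f g" "subspace W" "dim W = k"
      "\<forall>z\<in>U. z \<in> M \<longleftrightarrow> f z \<in> W"
    using assms(1) unfolding slice_at_def by blast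
  obtain U' V' :: "'b set" and f' g' W' where U': "y \<in> U'" "diffeo U' V' f' g'" "subspace W'" "dim W' = l"
      "\<forall>z\<in>U'. z \<in> N \<longleftrightarrow> f' z \<in> W'"
    using assms(2) unfolding slice_at_def by blast
  show ?thesis
    by (rule slice_atI[OF diffeo_Times[OF U(2) U'(2)] _ subspace_Times[OF U(3) U'(3)]])
      (use U U' dim_Times[OF U(3) U'(3)] in auto)
qed

unbundle cross3_syntax

section \<open>Affine subspaces, hyperplanes and spheres\<close>

lemma slice_at_affine:
  assumes "subspace W"
  shows "slice_at (dim W) {x. x - a \<in> W} x"
proof -
  have "diffeo UNIV UNIV (\<lambda>x. x - a) (\<lambda>x. x + a)"
    by (auto simp: diffeo_def intro!: smooth_intros)
  from slice_atI[OF this _ assms] show ?thesis by simp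
qed

lemma slice_at_UNIV: "slice_at DIM('a) (UNIV :: 'a::euclidean_space set) x"
  using slice_at_affine[OF subspace_UNIV, of 0 x] by simp

lemma slice_at_singleton: "slice_at 0 {a} x"
  using slice_at_affine[OF subspace_single_0, of a x] by simp

lemma slice_at_hyperplane:
  fixes u :: "'a::euclidean_space"
  assumes "u \<noteq> 0"
  shows "slice_at (DIM('a) - 1) {y. y \<bullet> u = h} x"
proof -
  \<comment> \<open>The base point is the foot of the perpendicular from the origin.\<close>
  have "{y. y \<bullet> u = h} = {y. y - (h / (u \<bullet> u)) *\<^sub>R u \<in> {z. u \<bullet> z = 0}}"
    using assms by (auto simp: inner_diff_right inner_commute)
  then show ?thesis
    using slice_at_affine[OF subspace_hyperplane[of u]] dim_hyperplane[OF assms] by metis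
qed

text \<open>With \<open>n\<close> the unit vector along \<open>x\<close>, the chart \<open>f\<close>
  keeps the part orthogonal to \<open>n\<close> and replaces the coordinate along \<open>n\<close>
  by \<open>z \<bullet> z - r\<^sup>2\<close>, so the sphere becomes flat. Spheres inside a subspace
  are included to cover circles in a plane.\<close>

lemma slice_at_sphere_subspace:
  assumes W: "subspace W" and x: "x \<in> W" "norm x = r" and r: "r > 0"
  shows "slice_at (dim W - 1) {z \<in> W. norm z = r} x"
proof -
  define n where "n = inverse r *\<^sub>R x"
  have n: "n \<in> W" "n \<bullet> n = 1"
    using assms by (auto simp: n_def subspace_scale power2_norm_eq_inner[symmetric] power2_eq_square)
  define f where "f z = z + (z \<bullet> z - r\<^sup>2 - z \<bullet> n) *\<^sub>R n" for z
  \<comment> \<open>The square of the lost coordinate \<open>z \<bullet> n\<close>, recovered from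
    \<open>y = f z\<close>: the squared radius \<open>y \<bullet> n + r\<^sup>2\<close> minus the
    squared length of the part orthogonal to \<open>n\<close>.\<close>
  define D where "D y = y \<bullet> n + r\<^sup>2 - y \<bullet> y + (y \<bullet> n)\<^sup>2" for y
  define g where "g y = y + (sqrt (D y) - y \<bullet> n) *\<^sub>R n" for y
  \<comment> \<open>On this half-space the coordinate along \<open>n\<close> is the positive root,
    which is the one that \<open>g\<close> takes.\<close>
  define U where "U = {z. z \<bullet> n > 0}"
  define V where "V = {y. D y > 0}"
  have open_UV: "open U" "open V"
    unfolding U_def V_def D_def by (intro open_Collect_less continuous_intros)+
  have f_n: "f z \<bullet> n = z \<bullet> z - r\<^sup>2" for z
    by (simp add: f_def inner_add_left n)
  have D_f: "D (f z) = (z \<bullet> n)\<^sup>2" for z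
  proof -
    have "f z \<bullet> f z = z \<bullet> z + 2 * (z \<bullet> z - r\<^sup>2 - z \<bullet> n) * (z \<bullet> n) + (z \<bullet> z - r\<^sup>2 - z \<bullet> n)\<^sup>2"
      by (simp add: f_def inner_add_left inner_add_right n inner_commute[of n z] power2_eq_square algebra_simps)
    then show ?thesis
      unfolding D_def f_n by (simp add: power2_eq_square algebra_simps)
  qed
  have g_n: "g y \<bullet> n = sqrt (D y)" for y
    by (simp add: g_def inner_add_left n)
  have g_g: "g y \<bullet> g y = y \<bullet> n + r\<^sup>2" if "D y > 0" for y
  proof -
    have "g y \<bullet> g y = y \<bullet> y - (y \<bullet> n)\<^sup>2 + (sqrt (D y))\<^sup>2"
      by (simp add: g_def inner_add_left inner_add_right n inner_commute[of n y] power2_eq_square algebra_simps)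
    then show ?thesis using that by (simp add: D_def)
  qed
  have gf: "g (f z) = z" if "z \<in> U" for z
    using that by (simp add: g_def D_f f_n U_def) (simp add: f_def algebra_simps)
  have fg: "f (g y) = y" if "y \<in> V" for y
    using that by (simp add: f_def g_g g_n V_def) (simp add: g_def algebra_simps)
  have "diffeo U V f g"
    unfolding diffeo_def
  proof (intro conjI ballI open_UV gf fg)
    show "f ` U \<subseteq> V" by (auto simp: U_def V_def D_f)
    show "g ` V \<subseteq> U" by (auto simp: U_def V_def g_n)
    show "smooth_on f U" "smooth_on g V"
      unfolding f_def[abs_def] g_def[abs_def] D_def power2_eq_square using open_UV
      by (auto intro!: smooth_intros simp: V_def D_def power2_eq_square)
  qed
  moreover have "subspace {y \<in> W. y \<bullet> n = 0}"
    using W by (auto simp: subspace_def inner_add_left)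
  moreover have "dim {y \<in> W. y \<bullet> n = 0} = dim W - 1"
  proof -
    have "{y \<in> W. \<forall>x\<in>span {n}. orthogonal x y} = {y \<in> W. y \<bullet> n = 0}"
      by (auto simp: span_singleton orthogonal_def inner_commute)
    moreover have "dim (span {n}) = 1" using n by (auto simp: dim_span)
    ultimately show ?thesis
      using dim_subspace_orthogonal_to_vectors[OF subspace_span W, of "{n}"] n W
      by (simp add: span_minimal)
  qed
  moreover have "z \<in> {z \<in> W. norm z = r} \<longleftrightarrow> f z \<in> {y \<in> W. y \<bullet> n = 0}" for z
  proof -
    \<comment> \<open>The chart moves points along \<open>n\<close> only, and \<open>n\<close> lies
      in \<open>W\<close>.\<close>
    have "f z \<in> W \<longleftrightarrow> z \<in> W"
      using W n(1) unfolding f_def by (metis add_diff_cancel subspace_add subspace_diff subspace_scale)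
    moreover have "norm z = r \<longleftrightarrow> z \<bullet> z = r\<^sup>2"
      using r by (metis norm_ge_zero order_less_imp_le power2_eq_iff_nonneg power2_norm_eq_inner)
    ultimately show ?thesis by (auto simp: f_n)
  qed
  moreover have "x \<in> U"
    using assms by (auto simp: U_def n_def power2_norm_eq_inner[symmetric])
  ultimately show ?thesis
    unfolding slice_at_def by blast
qed

lemma slice_at_sphere:
  fixes x :: "'a::euclidean_space"
  assumes "norm x = r" "r > 0"
  shows "slice_at (DIM('a) - 1) {z. norm z = r} x"
  using slice_at_sphere_subspace[OF subspace_UNIV UNIV_I assms] by simp

text \<open>For \<open>w \<noteq> 0\<close> this fixes the line of \<open>w\<close> and negates its
  orthogonal complement. For \<open>w = 0\<close> division by zero makes it minus the identity, so
  it is an involutive isometry for every \<open>w\<close>.\<close>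

definition half_turn :: "'a::euclidean_space \<Rightarrow> 'a \<Rightarrow> 'a" where
  "half_turn w x = (2 * (w \<bullet> x) / (w \<bullet> w)) *\<^sub>R w - x"

lemma half_turn_half_turn [simp]: "half_turn w (half_turn w x) = x"
  by (cases "w = 0") (auto simp: half_turn_def inner_diff_right)

lemma inner_half_turn: "half_turn w x \<bullet> half_turn w y = x \<bullet> y"
  by (cases "w = 0")
    (auto simp: half_turn_def inner_diff_left inner_diff_right inner_commute[of x w] divide_simps)

text \<open>
  For a unit vector \<open>u\<close> the half turn about the bisector of \<open>p\<close> and \<open>u\<close> exchanges their directions;
  unlike a rotation in their plane it is an involution depending smoothly on \<open>p\<close> without further choices.
\<close>

definition align :: "'a::euclidean_space \<Rightarrow> 'a \<Rightarrow> 'a \<Rightarrow> 'a" where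
  "align u p = half_turn (p + norm p *\<^sub>R u)"

lemma align_align [simp]: "align u p (align u p x) = x"
  by (simp add: align_def)

lemma inner_align: "align u p x \<bullet> align u p y = x \<bullet> y"
  by (simp add: align_def inner_half_turn)

lemma norm_align: "norm (align u p x) = norm x"
  by (simp add: norm_eq_sqrt_inner inner_align)

text \<open>The vectors \<open>p\<close> and \<open>norm p *\<^sub>R u\<close> have equal length, so
  each has the same inner product with their sum. Hence the coefficient in the half turn of
  \<open>p\<close> is 1, and \<open>p\<close> goes to the sum minus \<open>p\<close>.\<close>

lemma bisector_inner:
  assumes "norm u = 1"
  shows "(p + norm p *\<^sub>R u) \<bullet> (p + norm p *\<^sub>R u) = 2 * ((p + norm p *\<^sub>R u) \<bullet> p)"
proof -
  have "p \<bullet> p = norm p * norm p" "u \<bullet> u = 1"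
    using assms by (simp_all add: norm_eq_1 power2_norm_eq_inner[symmetric] power2_eq_square)
  then show ?thesis
    by (simp add: inner_add_left inner_add_right inner_commute[of p u] distrib_left)
qed

lemma bisector_nonzero:
  assumes "p \<bullet> u > 0"
  shows "p + norm p *\<^sub>R u \<noteq> 0"
proof -
  have "(p + norm p *\<^sub>R u) \<bullet> p > 0"
    using assms by (auto simp: inner_add_left inner_commute[of u p] intro!: add_pos_nonneg)
  then show ?thesis by force
qed

lemma align_self:
  assumes "norm u = 1" "p \<bullet> u > 0"
  shows "align u p p = norm p *\<^sub>R u"
proof -
  have "(p + norm p *\<^sub>R u) \<bullet> (p + norm p *\<^sub>R u) \<noteq> 0"
    using bisector_nonzero[OF assms(2)] by simp
  then have "2 * ((p + norm p *\<^sub>R u) \<bullet> p) / ((p + norm p *\<^sub>R u) \<bullet> (p + norm p *\<^sub>R u)) = 1"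
    using bisector_inner[OF assms(1), of p] by simp
  then show ?thesis
    by (simp only: align_def half_turn_def) simp
qed

text \<open>A condition relative to the moving vector \<open>p\<close> becomes one relative to the
  fixed \<open>u\<close>; this is how the tangent planes of the momentum sphere are
  trivialised.\<close>

lemma inner_align_axis:
  assumes "norm u = 1" "p \<bullet> u > 0"
  shows "x \<bullet> p = norm p * (align u p x \<bullet> u)"
  using inner_align[of u p x p] by (simp add: align_self[OF assms])

text \<open>Positivity keeps both \<open>f z\<close> and the bisector away from 0, where the norm
  and the quotient are smooth.\<close>

lemma smooth_on_align [smooth_intros]:
  assumes "open S" "smooth_on f S" "smooth_on g S" "\<forall>z\<in>S. f z \<bullet> u > 0"
  shows "smooth_on (\<lambda>z. align u (f z) (g z)) S"
proof -
  have "\<forall>z\<in>S. f z \<noteq> 0" using assms(4) by force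
  then show ?thesis
    using assms unfolding align_def half_turn_def
    by (intro smooth_intros) (simp_all add: bisector_nonzero)
qed

section \<open>The orbits are submanifolds\<close>

lemma orbit_set_iff [simp]:
  "(j, d, p, q, E) \<in> orbit_set E\<^sub>0 c \<longleftrightarrow> E = E\<^sub>0 \<and> orbit_equations c j d p q"
  by (simp add: orbit_set_def)

unbundle no cross3_syntax

section \<open>Product models and charts for the orbit types\<close>

lemma slice_at_UNIV_3: "slice_at 3 (UNIV :: (real^3) set) x"
  using slice_at_UNIV[of x] by simp

text \<open>The factors are \<open>j\<close>, \<open>d\<close>, \<open>p\<close>, \<open>q\<close>,
  \<open>E\<close> in this order; the last two are always points and contribute dimension 0.\<close>

lemmas slice_at_dual = slice_at_Times[OF _ slice_at_Times[OF _ slice_at_Times[OF _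
  slice_at_Times[OF slice_at_singleton slice_at_singleton]]]]

text \<open>The dimension is 2 + 0 + 2, from a plane of \<open>j\<close>, a point \<open>d\<close>
  and a sphere of \<open>p\<close>.\<close>

lemma slice_at_hyperplane_sphere:
  fixes j p u :: "real^3"
  assumes "p0 > 0" "norm u = 1" "norm p = p0"
  shows "slice_at 4 ({j. j \<bullet> u = h} \<times> {0 :: real^3} \<times> {p. norm p = p0} \<times> {q0 :: real} \<times> {E0 :: real}) (j, d, p, q, E)"
proof -
  have "u \<noteq> 0" using assms by force
  from slice_at_dual[OF slice_at_hyperplane[OF this] slice_at_singleton slice_at_sphere[OF assms(3,1)]]
  show ?thesis by simp
qed

text \<open>The dimension is 3 + 1 + 2; the circle is the sphere inside the plane orthogonal to
  \<open>u\<close>.\<close>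

lemma slice_at_circle_sphere:
  fixes d p u :: "real^3"
  assumes "p0 > 0" "norm u = 1" "norm p = p0" "r > 0" "norm d = r" "d \<bullet> u = 0"
  shows "slice_at 6 ((UNIV :: (real^3) set) \<times> {d. d \<bullet> u = 0 \<and> norm d = r} \<times> {p. norm p = p0} \<times>
    {q0 :: real} \<times> {E0 :: real}) (j, d, p, q, E)"
proof -
  have u: "u \<noteq> 0" using assms by force
  have "subspace {d. d \<bullet> u = 0}" using subspace_hyperplane[of u] by (simp add: inner_commute)
  moreover have "dim {d. d \<bullet> u = 0} = 2" using dim_hyperplane[OF u] by (simp add: inner_commute)
  ultimately have "slice_at 1 {d. d \<bullet> u = 0 \<and> norm d = r} d"
    using slice_at_sphere_subspace[of "{d. d \<bullet> u = 0}" d r] assms by simp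
  from slice_at_dual[OF slice_at_UNIV_3 this slice_at_sphere[OF assms(3,1)]]
  show ?thesis by simp
qed

text \<open>A global shear of \<open>j\<close> does it. Taking the constant \<open>e\<close> in
  place of the coordinate \<open>q\<close> keeps it polynomial on all of the dual. The free
  \<open>d\<close> and \<open>p\<close> account for the 6.\<close>

lemma slice_at_Charged:
  fixes x :: dipole_dual
  assumes "e \<noteq> 0" "slice_at k N (fst x + inverse e *\<^sub>R cross3 (fst (snd (snd x))) (fst (snd x)))"
  shows "slice_at (k + 6) {(j, d, p, q, E). E = E0 \<and> q = e \<and> j + inverse e *\<^sub>R cross3 p d \<in> N} x"
proof -
  obtain j d p q E where x: "x = (j, d, p, q, E)" by (cases x)
  let ?s = "\<lambda>z :: dipole_dual. inverse e *\<^sub>R cross3 (fst (snd (snd z))) (fst (snd z))"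
  have "diffeo UNIV UNIV (\<lambda>z. (fst z + ?s z, snd z)) (\<lambda>z. (fst z - ?s z, snd z))"
    by (auto simp: diffeo_def intro!: smooth_intros)
  moreover have "slice_at (k + 6) (N \<times> UNIV \<times> UNIV \<times> {e} \<times> {E0}) (fst x + ?s x, snd x)"
    using slice_at_dual[OF assms(2) slice_at_UNIV_3 slice_at_UNIV_3, of e E0] by (simp add: x)
  ultimately show ?thesis
    by (rule slice_at_transfer[OF _ UNIV_I]) auto
qed

lemma ex_half_space:
  fixes p :: "real^3"
  assumes "p \<noteq> 0"
  obtains u where "norm u = 1" "p \<bullet> u > 0"
  using assms by (intro that[of "p /\<^sub>R norm p"]) (auto simp: power2_norm_eq_inner[symmetric])

lemma open_dual_half_space: "open {z :: dipole_dual. fst (snd (snd z)) \<bullet> u > 0}"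
  by (intro open_Collect_less continuous_intros)

text \<open>Serves \<open>Momentum\<close> with \<open>c = 0\<close>, \<open>Collinear\<close> with
  \<open>c = \<sigma> * d0 / p0\<close>, and \<open>Dipole\<close> after exchanging \<open>d\<close>
  and \<open>p\<close>. The chart subtracts \<open>c *\<^sub>R p\<close> from \<open>d\<close> and
  turns \<open>j\<close>, keeping \<open>p\<close>.\<close>

lemma slice_at_momentum:
  fixes x :: dipole_dual
  assumes "p0 > 0" "x \<in> M"
    and M: "M = {(j, d, p, q, E). E = E0 \<and> q = 0 \<and> norm p = p0 \<and> d = c *\<^sub>R p \<and> j \<bullet> p = h * norm p}"
  shows "slice_at 4 M x"
proof -
  obtain j d p q E where x: "x = (j, d, p, q, E)" by (cases x)
  have p: "norm p = p0" using assms x by auto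
  have "p \<noteq> 0" using p \<open>p0 > 0\<close> by auto
  then obtain u where u: "norm u = 1" "p \<bullet> u > 0" using ex_half_space by blast
  define A where "A = {z :: dipole_dual. fst (snd (snd z)) \<bullet> u > 0}"
  \<comment> \<open>The shear is parametrised by \<open>t\<close> so that \<open>F (- c)\<close> is
    the inverse of \<open>F c\<close>: the turn is an involution and \<open>p\<close> does not
    change.\<close>
  define F where "F t z = (align u (fst (snd (snd z))) (fst z), fst (snd z) - t *\<^sub>R fst (snd (snd z)), snd (snd z))"
    for t and z :: dipole_dual
  have "open A" unfolding A_def by (rule open_dual_half_space)
  then have "smooth_on (F t) A" for t
    unfolding F_def[abs_def] by (auto intro!: smooth_intros simp: A_def)
  with \<open>open A\<close> have dF: "diffeo A A (F c) (F (- c))"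
    by (auto simp: diffeo_def F_def A_def)
  have N: "slice_at 4 ({j. j \<bullet> u = h} \<times> {0} \<times> {p. norm p = p0} \<times> {0} \<times> {E0}) (F c x)"
    using slice_at_hyperplane_sphere[OF \<open>p0 > 0\<close> u(1) p] by (simp add: F_def x)
  have zM: "z \<in> M \<longleftrightarrow> F c z \<in> {j. j \<bullet> u = h} \<times> {0} \<times> {p. norm p = p0} \<times> {0} \<times> {E0}"
    if "z \<in> A" for z
  proof -
    obtain j d p q E where z: "z = (j, d, p, q, E)" by (cases z)
    then have "j \<bullet> p = norm p * (align u p j \<bullet> u)"
      using inner_align_axis[OF u(1)] that by (simp add: A_def)
    then show ?thesis using \<open>p0 > 0\<close> by (auto simp: z F_def M)
  qed
  show ?thesis
    by (rule slice_at_transfer[OF dF _ N zM]) (use u in \<open>auto simp: A_def x\<close>)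
qed

text \<open>Here \<open>j\<close> is free and the turn acts on the part of \<open>d\<close>
  orthogonal to \<open>p\<close>, which then runs through a circle in the fixed plane orthogonal to
  \<open>u\<close>.\<close>

lemma slice_at_generic:
  fixes x :: dipole_dual
  assumes "p0 > 0" "r > 0" "x \<in> M"
    and M: "M = {(j, d, p, q, E). E = E0 \<and> q = 0 \<and> norm p = p0 \<and>
      (d - c *\<^sub>R p) \<bullet> p = 0 \<and> norm (d - c *\<^sub>R p) = r}"
  shows "slice_at 6 M x"
proof -
  obtain j d p q E where x: "x = (j, d, p, q, E)" by (cases x)
  have p: "norm p = p0" and d: "(d - c *\<^sub>R p) \<bullet> p = 0" "norm (d - c *\<^sub>R p) = r"
    using assms x by auto
  have "p \<noteq> 0" using p \<open>p0 > 0\<close> by auto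
  then obtain u where u: "norm u = 1" "p \<bullet> u > 0" using ex_half_space by blast
  define A where "A = {z :: dipole_dual. fst (snd (snd z)) \<bullet> u > 0}"
  define F where "F z = (fst z, align u (fst (snd (snd z))) (fst (snd z) - c *\<^sub>R fst (snd (snd z))), snd (snd z))"
    for z :: dipole_dual
  \<comment> \<open>The turn acts on the sheared \<open>d\<close>, so it has to be undone before the
    shear.\<close>
  define G where "G z = (fst z, align u (fst (snd (snd z))) (fst (snd z)) + c *\<^sub>R fst (snd (snd z)), snd (snd z))"
    for z :: dipole_dual
  have "open A" unfolding A_def by (rule open_dual_half_space)
  then have "smooth_on F A" "smooth_on G A"
    unfolding F_def[abs_def] G_def[abs_def] by (auto intro!: smooth_intros simp: A_def)
  with \<open>open A\<close> have dF: "diffeo A A F G"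
    by (auto simp: diffeo_def F_def G_def A_def)
  let ?N = "(UNIV :: (real^3) set) \<times> {d. d \<bullet> u = 0 \<and> norm d = r} \<times> {p. norm p = p0} \<times> {0 :: real} \<times> {E0}"
  have orth: "(d - c *\<^sub>R p) \<bullet> p = 0 \<longleftrightarrow> align u p (d - c *\<^sub>R p) \<bullet> u = 0" if "p \<bullet> u > 0" for d p
  proof -
    have "p \<noteq> 0" using that by auto
    then show ?thesis using inner_align_axis[OF u(1) that, of "d - c *\<^sub>R p"] by simp
  qed
  have N: "slice_at 6 ?N (F x)"
    using slice_at_circle_sphere[OF \<open>p0 > 0\<close> u(1) p \<open>r > 0\<close>, of "align u p (d - c *\<^sub>R p)"] orth[OF u(2)] d
    by (simp add: F_def x norm_align)
  have zM: "z \<in> M \<longleftrightarrow> F z \<in> ?N" if "z \<in> A" for z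
  proof -
    obtain j d p q E where z: "z = (j, d, p, q, E)" by (cases z)
    then show ?thesis using orth[of p d] that by (auto simp: F_def M norm_align A_def)
  qed
  show ?thesis
    by (rule slice_at_transfer[OF dF _ N zM]) (use u in \<open>auto simp: A_def x\<close>)
qed

lemma slice_at_swap:
  fixes x :: dipole_dual
  assumes "slice_at k {(j, p, d, q, E). (j, d, p, q, E) \<in> M} (fst x, fst (snd (snd x)), fst (snd x), snd (snd (snd x)))"
  shows "slice_at k M x"
proof -
  let ?F = "\<lambda>z :: dipole_dual. (fst z, fst (snd (snd z)), fst (snd z), snd (snd (snd z)))"
  have "diffeo UNIV UNIV ?F ?F"
    by (auto simp: diffeo_def intro!: smooth_intros)
  from slice_at_transfer[OF this UNIV_I assms] show ?thesis by auto
qed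

text \<open>The equality case of Cauchy-Schwarz: the squared norm of
  \<open>p0 *\<^sub>R d - (\<sigma> * d0) *\<^sub>R p\<close> expands to 0.\<close>

lemma dual_collinear_iff:
  fixes p d :: "'a::real_inner"
  assumes "\<sigma> = 1 \<or> \<sigma> = -1" "p0 > 0" "d0 > 0" "norm p = p0"
  shows "norm d = d0 \<and> p \<bullet> d = \<sigma> * (p0 * d0) \<longleftrightarrow> d = (\<sigma> * d0 / p0) *\<^sub>R p"
proof
  have pp: "p \<bullet> p = p0\<^sup>2" using assms(4) by (simp add: power2_norm_eq_inner[symmetric])
  have \<sigma>: "\<sigma> * \<sigma> = 1" "\<bar>\<sigma>\<bar> = 1" using assms(1) by auto
  assume d: "norm d = d0 \<and> p \<bullet> d = \<sigma> * (p0 * d0)"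
  then have dd: "d \<bullet> d = d0\<^sup>2" by (simp add: power2_norm_eq_inner[symmetric])
  have "(p0 *\<^sub>R d - (\<sigma> * d0) *\<^sub>R p) \<bullet> (p0 *\<^sub>R d - (\<sigma> * d0) *\<^sub>R p) =
      p0\<^sup>2 * d0\<^sup>2 - 2 * (p0 * d0)\<^sup>2 * (\<sigma> * \<sigma>) + (d0 * p0)\<^sup>2 * (\<sigma> * \<sigma>)"
    using d dd pp
    by (simp add: inner_diff_left inner_diff_right inner_commute[of d p] power2_eq_square algebra_simps)
  also have "\<dots> = 0" by (simp add: \<sigma> power_mult_distrib)
  finally have "p0 *\<^sub>R d = (\<sigma> * d0) *\<^sub>R p" by simp
  then have "inverse p0 *\<^sub>R p0 *\<^sub>R d = inverse p0 *\<^sub>R (\<sigma> * d0) *\<^sub>R p" by simp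
  then show "d = (\<sigma> * d0 / p0) *\<^sub>R p"
    using assms(2) by (simp add: field_simps)
next
  have "\<bar>\<sigma>\<bar> = 1" using assms(1) by auto
  moreover assume "d = (\<sigma> * d0 / p0) *\<^sub>R p"
  moreover have "p \<bullet> p = p0 * p0"
    using assms(4) by (simp add: power2_norm_eq_inner[symmetric] power2_eq_square)
  ultimately show "norm d = d0 \<and> p \<bullet> d = \<sigma> * (p0 * d0)"
    using assms by (simp add: abs_mult)
qed

text \<open>Pythagoras: the component of \<open>d\<close> along \<open>p\<close> has signed length
  \<open>d0 * cos \<theta>\<close>, leaving \<open>d0 * sin \<theta>\<close> for the orthogonal
  part. Positivity of the sine allows passing from squares to lengths.\<close>

lemma dual_generic_iff:
  fixes p d :: "'a::real_inner"
  assumes "p0 > 0" "d0 > 0" "sin \<theta> > 0" "norm p = p0"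
  shows "norm d = d0 \<and> p \<bullet> d = p0 * d0 * cos \<theta> \<longleftrightarrow>
    (d - (d0 * cos \<theta> / p0) *\<^sub>R p) \<bullet> p = 0 \<and> norm (d - (d0 * cos \<theta> / p0) *\<^sub>R p) = d0 * sin \<theta>"
proof -
  define z where "z = d - (d0 * cos \<theta> / p0) *\<^sub>R p"
  have pp: "p \<bullet> p = p0 * p0"
    using assms(4) by (simp add: power2_norm_eq_inner[symmetric] power2_eq_square)
  have d: "d = z + (d0 * cos \<theta> / p0) *\<^sub>R p" by (simp add: z_def)
  have zp: "p \<bullet> d = z \<bullet> p + p0 * d0 * cos \<theta>"
    using assms(1) pp by (simp add: d inner_add_right inner_commute)
  have "norm d = d0 \<longleftrightarrow> norm z = d0 * sin \<theta>" if "z \<bullet> p = 0"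
  proof -
    have "(norm d)\<^sup>2 = (norm z)\<^sup>2 + d0\<^sup>2 * (cos \<theta>)\<^sup>2"
      using assms(1) pp that unfolding power2_norm_eq_inner
      by (simp add: d inner_add_right inner_add_left inner_commute[of p z] power2_eq_square)
    moreover have "d0\<^sup>2 * (cos \<theta>)\<^sup>2 = d0\<^sup>2 - (d0 * sin \<theta>)\<^sup>2"
      by (simp add: cos_squared_eq algebra_simps power_mult_distrib)
    ultimately have "(norm d)\<^sup>2 = d0\<^sup>2 \<longleftrightarrow> (norm z)\<^sup>2 = (d0 * sin \<theta>)\<^sup>2" by linarith
    then show ?thesis
      using assms by (simp add: power2_eq_iff_nonneg)
  qed
  then show ?thesis using zp by (auto simp: z_def)
qed

text \<open>Relates the two normalisations of the spin vector in the charged families.\<close>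

lemma norm_spin:
  fixes j x :: "'a::real_normed_vector"
  assumes "e \<noteq> 0"
  shows "norm (e *\<^sub>R j + x) = \<bar>e\<bar> * norm (j + inverse e *\<^sub>R x)"
proof -
  have "e *\<^sub>R j + x = e *\<^sub>R (j + inverse e *\<^sub>R x)" using assms by (simp add: scaleR_add_right)
  then show ?thesis by simp
qed

lemma norm_spin_iff:
  fixes j x :: "'a::real_normed_vector"
  assumes "e \<noteq> 0"
  shows "norm (j + inverse e *\<^sub>R x) = S \<longleftrightarrow> norm (e *\<^sub>R j + x) = \<bar>e\<bar> * S"
  using assms by (simp add: norm_spin)

lemma spin_eq_0_iff:
  fixes j x :: "'a::real_normed_vector"
  assumes "e \<noteq> 0"
  shows "e *\<^sub>R j + x = 0 \<longleftrightarrow> j + inverse e *\<^sub>R x = 0"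
  using norm_spin[OF assms, of j x] assms by (metis abs_eq_0 mult_eq_0_iff norm_eq_zero)

lemma orbit_equations_Generic_iff:
  assumes "admissible (Generic p0 d0 \<theta>)"
  shows "orbit_equations (Generic p0 d0 \<theta>) j d p q \<longleftrightarrow> q = 0 \<and> norm p = p0 \<and>
    (d - (d0 * cos \<theta> / p0) *\<^sub>R p) \<bullet> p = 0 \<and> norm (d - (d0 * cos \<theta> / p0) *\<^sub>R p) = d0 * sin \<theta>"
  using dual_generic_iff[of p0 d0 \<theta> p d] assms sin_gt_zero[of \<theta>] by auto

lemma orbit_equations_Collinear_iff:
  assumes "admissible (Collinear \<sigma> p0 d0 h)"
  shows "orbit_equations (Collinear \<sigma> p0 d0 h) j d p q \<longleftrightarrow>
    q = 0 \<and> norm p = p0 \<and> d = (\<sigma> * d0 / p0) *\<^sub>R p \<and> j \<bullet> p = h * norm p"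
  using dual_collinear_iff[of \<sigma> p0 d0 p d] assms by auto

lemma embedded_submanifold_orbit_set:
  assumes "admissible c"
  shows "embedded_submanifold (orbit_dim c) (orbit_set E\<^sub>0 c)"
proof (rule embedded_submanifoldI)
  fix x assume x: "x \<in> orbit_set E\<^sub>0 c"
  obtain j d p q E where xd: "x = (j, d, p, q, E)" by (cases x)
  show "slice_at (orbit_dim c) (orbit_set E\<^sub>0 c) x"
  proof (cases c)
    case (Charged e)
    then have e: "e \<noteq> 0" using assms by simp
    have "orbit_set E\<^sub>0 c = {(j, d, p, q, E). E = E\<^sub>0 \<and> q = e \<and> j + inverse e *\<^sub>R cross3 p d \<in> {0}}"
      by (auto simp: orbit_set_def Charged spin_eq_0_iff[OF e])
    with slice_at_Charged[OF e slice_at_singleton] show ?thesis by (simp add: Charged)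
  next
    case (Charged_Spin e S)
    then have e: "e \<noteq> 0" "S > 0" using assms by simp_all
    have "orbit_set E\<^sub>0 c = {(j, d, p, q, E). E = E\<^sub>0 \<and> q = e \<and> j + inverse e *\<^sub>R cross3 p d \<in> {s. norm s = S}}"
      by (auto simp: orbit_set_def Charged_Spin)
    moreover have "norm (fst x + inverse e *\<^sub>R cross3 (fst (snd (snd x))) (fst (snd x))) = S"
      using x by (simp add: xd Charged_Spin)
    ultimately show ?thesis
      using slice_at_Charged[OF e(1) slice_at_sphere[OF _ e(2)]] by (simp add: Charged_Spin)
  next
    case Vacuum
    then have "orbit_set E\<^sub>0 c = {(0, 0, 0, 0, E\<^sub>0)}" by (auto simp: orbit_set_def)
    then show ?thesis using Vacuum slice_at_singleton by simp
  next
    case (Spin j0)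
    then have "orbit_set E\<^sub>0 c = {s. norm s = j0} \<times> {0} \<times> {0} \<times> {0} \<times> {E\<^sub>0}"
      by (auto simp: orbit_set_def)
    moreover have "norm j = j0" "j0 > 0" using x assms by (auto simp: xd Spin)
    ultimately show ?thesis
      using slice_at_dual[OF slice_at_sphere[of j j0] slice_at_singleton slice_at_singleton, of 0 0 0 E\<^sub>0 d p q E]
      by (simp add: Spin xd)
  next
    case (Dipole d0 h)
    \<comment> \<open>After the exchange the nonzero dipole moment plays the part of the momentum,
      with coefficient 0.\<close>
    let ?M = "{(j, p, d, q, E). (j, d, p, q, E) \<in> orbit_set E\<^sub>0 c}"
    have "?M = {(j, d, p, q, E). E = E\<^sub>0 \<and> q = 0 \<and> norm p = d0 \<and> d = 0 *\<^sub>R p \<and> j \<bullet> p = h * norm p}"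
      by (auto simp: Dipole)
    note M = slice_at_momentum[OF _ _ this]
    show ?thesis
      by (rule slice_at_swap) (use M x assms in \<open>auto simp: Dipole xd\<close>)
  next
    case (Momentum p0 h)
    have "orbit_set E\<^sub>0 c = {(j, d, p, q, E). E = E\<^sub>0 \<and> q = 0 \<and> norm p = p0 \<and> d = 0 *\<^sub>R p \<and> j \<bullet> p = h * norm p}"
      by (auto simp: Momentum orbit_set_def)
    from slice_at_momentum[OF _ x this] show ?thesis
      using assms by (auto simp: Momentum)
  next
    case (Collinear \<sigma> p0 d0 h)
    have "orbit_set E\<^sub>0 c = {(j, d, p, q, E). E = E\<^sub>0 \<and> q = 0 \<and> norm p = p0 \<and>
        d = (\<sigma> * d0 / p0) *\<^sub>R p \<and> j \<bullet> p = h * norm p}"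
      unfolding orbit_set_def Collinear orbit_equations_Collinear_iff[OF assms[unfolded Collinear]] ..
    from slice_at_momentum[OF _ x this] show ?thesis
      using assms by (auto simp: Collinear)
  next
    case (Generic p0 d0 \<theta>)
    have M: "orbit_set E\<^sub>0 c = {(j, d, p, q, E). E = E\<^sub>0 \<and> q = 0 \<and> norm p = p0 \<and>
        (d - (d0 * cos \<theta> / p0) *\<^sub>R p) \<bullet> p = 0 \<and> norm (d - (d0 * cos \<theta> / p0) *\<^sub>R p) = d0 * sin \<theta>}"
      unfolding orbit_set_def Generic orbit_equations_Generic_iff[OF assms[unfolded Generic]] ..
    have "p0 > 0" "d0 * sin \<theta> > 0" using assms sin_gt_zero[of \<theta>] by (auto simp: Generic)
    from slice_at_generic[OF this x M] show ?thesis by (simp add: Generic)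
  qed
qed

unbundle cross3_syntax

section \<open>Classification of the orbits\<close>

lemma rotation_matrix_norm:
  "rotation_matrix R \<Longrightarrow> norm (R *v x) = norm x" for R :: "real^3^3"
  by (simp add: norm_eq_sqrt_inner rotation_matrix_inner)

text \<open>The terms in \<open>v\<close> and \<open>a\<close> of \<open>q *\<^sub>R j'\<close>
  cancel against those of \<open>p' \<times> d'\<close>, including the quadratic one.\<close>

lemma coadjoint_spin:
  fixes R :: "real^3^3"
  assumes "rotation_matrix R" "coadjoint (R, v, a, l, s) (j, d, p, q, E) = (j', d', p', q', E')"
  shows "q *\<^sub>R j' + p' \<times> d' = R *v (q *\<^sub>R j + p \<times> d)"
proof -
  have "(R *v p) \<times> a = - (a \<times> (R *v p))" "(R *v d) \<times> v = - (v \<times> (R *v d))"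
    by (rule cross_skew)+
  then show ?thesis
    using assms(2) cross_rotation_matrix[OF assms(1)]
    by (auto simp: coadjoint_def matrix_vector_right_distrib matrix_vector_mult_scaleR cross_add_left
        cross_add_right cross_mult_left cross_mult_right scaleR_add_right scaleR_diff_right Cross3.left_diff_distrib)
qed

lemma coadjoint_orbit_set:
  assumes "g \<in> carrier dipole_group" "admissible c" "\<alpha> \<in> orbit_set E\<^sub>0 c"
  shows "coadjoint g \<alpha> \<in> orbit_set E\<^sub>0 c"
proof -
  obtain R v a l s where g: "g = (R, v, a, l, s)" and R: "rotation_matrix R"
    using assms(1) by (auto simp: dipole_group_def)
  obtain j d p q E where \<alpha>: "\<alpha> = (j, d, p, q, E)" by (cases \<alpha>)
  obtain j' d' p' q' E' where \<alpha>': "coadjoint g \<alpha> = (j', d', p', q', E')" by (cases "coadjoint g \<alpha>")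
  note spin = coadjoint_spin[OF R \<alpha>'[unfolded g \<alpha>]]
  have eqs: "j' = R *v j + v \<times> (R *v d) + a \<times> (R *v p) + q *\<^sub>R (v \<times> a)" "d' = R *v d + q *\<^sub>R a"
    "p' = R *v p - q *\<^sub>R v" "q' = q" "E' = E"
    using \<alpha>' unfolding g \<alpha> coadjoint_def by auto
  have E: "E = E\<^sub>0" and eq: "orbit_equations c j d p q" using assms(3) by (simp_all add: \<alpha>)
  note simps = eqs E rotation_matrix_norm[OF R] rotation_matrix_inner[OF R] inner_add_left dot_cross_self
  have "orbit_equations c j' d' p' q'"
  proof (cases c)
    case (Charged e)
    then show ?thesis using eq spin by (simp add: eqs(4))
  next
    case (Charged_Spin e S)
    then have "e \<noteq> 0" using assms by simp
    then show ?thesis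
      using eq spin rotation_matrix_norm[OF R, of "q *\<^sub>R j + p \<times> d"]
      by (simp add: Charged_Spin eqs(4) norm_spin_iff)
  next
    \<comment> \<open>In the form where \<open>d\<close> is a multiple of \<open>p\<close>, the term
      \<open>v \<times> (R *v d)\<close> is visibly orthogonal to \<open>R *v p\<close>, so it drops
      out of \<open>j' \<bullet> p'\<close>.\<close>
    case (Collinear \<sigma> p0 d0 h)
    show ?thesis
      using eq assms(2) unfolding Collinear
      by (simp only: orbit_equations_Collinear_iff) (simp add: simps matrix_vector_mult_scaleR cross_mult_right)
  qed (use eq in \<open>simp_all add: simps\<close>)
  then show ?thesis by (simp add: \<alpha>' eqs E)
qed

section \<open>Transitivity on each orbit set\<close>

lemma ex_coadjoint_eqI:
  assumes "rotation_matrix R" "d' = R *v d + q *\<^sub>R a" "p' = R *v p - q *\<^sub>R v"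
    "j' = R *v j + v \<times> (R *v d) + a \<times> (R *v p) + q *\<^sub>R (v \<times> a)"
  shows "\<exists>g\<in>carrier dipole_group. coadjoint g (j, d, p, q, E) = (j', d', p', q, E)"
  \<comment> \<open>The two central parameters act trivially and are set to 0.\<close>
  using assms by (intro bexI[of _ "(R, v, a, 0, 0)"]) (auto simp: coadjoint_def dipole_group_def)

text \<open>Choose \<open>R\<close> to match the spin vectors, then solve for \<open>v\<close> and
  \<open>a\<close>, which takes \<open>q \<noteq> 0\<close>, to match \<open>p\<close> and
  \<open>d\<close>. By \<open>coadjoint_spin\<close> the resulting \<open>k\<close> is forced to
  equal \<open>j'\<close>.\<close>

lemma coadjoint_transitive_charged:
  assumes "q \<noteq> 0" "norm (q *\<^sub>R j + p \<times> d) = norm (q *\<^sub>R j' + p' \<times> d')"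
  shows "\<exists>g\<in>carrier dipole_group. coadjoint g (j, d, p, q, E) = (j', d', p', q, E)"
proof -
  obtain R where R: "rotation_matrix R" "R *v (q *\<^sub>R j + p \<times> d) = q *\<^sub>R j' + p' \<times> d'"
    using ex_rotation_matrix[OF assms(2)] .
  define v where "v = inverse q *\<^sub>R (R *v p - p')"
  define a where "a = inverse q *\<^sub>R (d' - R *v d)"
  have d': "d' = R *v d + q *\<^sub>R a" and p': "p' = R *v p - q *\<^sub>R v"
    using assms(1) by (simp_all add: a_def v_def)
  obtain k where k: "coadjoint (R, v, a, 0, 0) (j, d, p, q, E) = (k, d', p', q, E)"
    by (simp add: coadjoint_def d' p')
  have "q *\<^sub>R k = q *\<^sub>R j'"
    using coadjoint_spin[OF R(1) k] R(2) by simp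
  then have "k = j'" using assms(1) by simp
  then show ?thesis
    using k R(1) by (intro bexI[of _ "(R, v, a, 0, 0)"]) (auto simp: dipole_group_def)
qed

lemma coadjoint_transitive:
  assumes "admissible c" "\<alpha> \<in> orbit_set E\<^sub>0 c" "\<beta> \<in> orbit_set E\<^sub>0 c"
  shows "\<exists>g\<in>carrier dipole_group. coadjoint g \<alpha> = \<beta>"
proof -
  obtain j d p q E where \<alpha>: "\<alpha> = (j, d, p, q, E)" by (cases \<alpha>)
  obtain j' d' p' q' E' where \<beta>: "\<beta> = (j', d', p', q', E')" by (cases \<beta>)
  have E: "E = E\<^sub>0" "E' = E\<^sub>0" and eq: "orbit_equations c j d p q" and eq': "orbit_equations c j' d' p' q'"
    using assms(2,3) by (simp_all add: \<alpha> \<beta>)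
  \<comment> \<open>Shared by \<open>Momentum\<close> and \<open>Collinear\<close>. Once
    \<open>p\<close> is matched, \<open>a \<times> p'\<close> already covers all remaining
    differences of \<open>j\<close>, so \<open>v = 0\<close> suffices.\<close>
  have momentum: ?thesis if m: "q = 0" "q' = 0" "norm p = norm p'" "p' \<noteq> 0" "d = k *\<^sub>R p" "d' = k *\<^sub>R p'" "j \<bullet> p = j' \<bullet> p'" for k
  proof -
    obtain R where R: "rotation_matrix R" "R *v p = p'"
      using ex_rotation_matrix[OF m(3)] .
    have "(j' - R *v j) \<bullet> p' = 0"
      using m(7) rotation_matrix_inner[OF R(1), of j p] R(2) by (simp add: inner_diff_left)
    then obtain a where a: "a \<times> p' = j' - R *v j" using ex_cross_eq m(4) by metis
    show ?thesis
      unfolding \<alpha> \<beta> E m(1,2)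
      by (rule ex_coadjoint_eqI[OF R(1), of _ _ _ a _ _ 0]) (use a m R in \<open>simp_all add: matrix_vector_mult_scaleR\<close>)
  qed
  show ?thesis
  proof (cases c)
    case (Charged e)
    then show ?thesis
      using eq eq' assms(1) coadjoint_transitive_charged[of q j p d j' p' d'] by (simp add: \<alpha> \<beta> E)
  next
    case (Charged_Spin e S)
    then show ?thesis
      using eq eq' assms(1) coadjoint_transitive_charged[of q j p d j' p' d'] by (simp add: \<alpha> \<beta> E norm_spin_iff)
  next
    case Vacuum
    then show ?thesis
      using eq eq' ex_coadjoint_eqI[OF rotation_matrix_mat_1, of 0 0 0 0 0 0 0] by (simp add: \<alpha> \<beta> E)
  next
    case (Spin j0)
    then obtain R where "rotation_matrix R" "R *v j = j'"
      using eq eq' ex_rotation_matrix[of j j'] by auto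
    then show ?thesis
      using eq eq' ex_coadjoint_eqI[of R 0 0 0 0 0 0 0 j' j] by (simp add: \<alpha> \<beta> E Spin)
  next
    case (Dipole d0 h)
    then have h: "norm d = norm d'" "d' \<noteq> 0" "j \<bullet> d = j' \<bullet> d'" using eq eq' assms(1) by auto
    obtain R where R: "rotation_matrix R" "R *v d = d'"
      using ex_rotation_matrix[OF h(1)] .
    have "(j' - R *v j) \<bullet> d' = 0"
      using h(3) rotation_matrix_inner[OF R(1), of j d] R(2) by (simp add: inner_diff_left)
    then obtain v where v: "v \<times> d' = j' - R *v j" using ex_cross_eq h(2) by metis
    show ?thesis
      using eq eq' ex_coadjoint_eqI[OF R(1), of d' d 0 0 0 0 v j' j E\<^sub>0] v R(2) by (simp add: \<alpha> \<beta> E Dipole)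
  next
    case (Momentum p0 h)
    then show ?thesis using eq eq' assms(1) by (intro momentum[of 0]) auto
  next
    case (Collinear \<sigma> p0 d0 h)
    show ?thesis
      using eq eq' assms(1) unfolding Collinear
      by (intro momentum[of "\<sigma> * d0 / p0"]) (simp_all only: orbit_equations_Collinear_iff, auto)
  next
    case (Generic p0 d0 \<theta>)
    define k where "k = d0 * cos \<theta> / p0"
    define z where "z = d - k *\<^sub>R p"
    define z' where "z' = d' - k *\<^sub>R p'"
    have h: "q = 0" "norm p = p0" "z \<bullet> p = 0" "norm z = d0 * sin \<theta>"
      "q' = 0" "norm p' = p0" "z' \<bullet> p' = 0" "norm z' = d0 * sin \<theta>"
      using eq eq' assms(1) unfolding Generic by (simp_all only: orbit_equations_Generic_iff z_def z'_def k_def)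
    have pos: "p0 > 0" "d0 * sin \<theta> > 0" using assms(1) sin_gt_zero[of \<theta>] by (auto simp: Generic)
    have nz: "p \<noteq> 0" "z \<noteq> 0" "p' \<noteq> 0" "z' \<noteq> 0" using h pos by auto
    \<comment> \<open>Matching the orthogonal pairs \<open>p, z\<close> and \<open>p', z'\<close>
      also matches \<open>d\<close>, a fixed linear combination of its pair. Any difference of
      \<open>j\<close> is then a sum of two cross products.\<close>
    obtain R where R: "rotation_matrix R" "R *v p = p'" "R *v z = z'"
      using ex_rotation_matrix_pair[of p p' z z'] h nz by (auto simp: inner_commute)
    have "R *v d = R *v z + k *\<^sub>R (R *v p)"
      by (simp add: z_def matrix_vector_mult_diff_distrib matrix_vector_mult_scaleR)
    then have Rd: "R *v d = d'" by (simp add: R z'_def)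
    obtain v a where "v \<times> d' + a \<times> p' = j' - R *v j"
      using ex_cross_add_cross_eq[of p' d' k] h nz unfolding z'_def by metis
    then have "j' = R *v j + v \<times> d' + a \<times> p'" by (simp add: algebra_simps)
    then show ?thesis
      unfolding \<alpha> \<beta> E h(1,5) by (intro ex_coadjoint_eqI[OF R(1), of _ _ _ a _ _ v]) (simp_all add: R Rd)
  qed
qed

section \<open>Realisation, uniqueness and existence of labels\<close>

lemma orbit_set_nonempty:
  assumes "admissible c"
  shows "orbit_set E\<^sub>0 c \<noteq> {}"
proof -
  define e1 :: "real^3" where "e1 = axis 1 1"
  define e2 :: "real^3" where "e2 = axis 2 1"
  have e: "norm e1 = 1" "norm e2 = 1" "e1 \<bullet> e1 = 1" "e2 \<bullet> e2 = 1" "e1 \<bullet> e2 = 0" "e2 \<bullet> e1 = 0"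
    by (simp_all add: e1_def e2_def inner_axis_axis)
  have "\<exists>j d p q. orbit_equations c j d p q"
  proof (cases c)
    case (Charged e)
    then show ?thesis by (auto intro!: exI[of _ "0 :: real^3"])
  next
    case (Charged_Spin e S)
    have "orbit_equations c (S *\<^sub>R e1) 0 0 e"
      using assms e by (simp add: Charged_Spin)
    then show ?thesis by blast
  next
    case (Spin j0)
    then show ?thesis using assms e by (auto intro!: exI[of _ "j0 *\<^sub>R e1"])
  next
    case (Dipole d0 h)
    have "orbit_equations c (h *\<^sub>R e1) (d0 *\<^sub>R e1) 0 0"
      using assms e by (simp add: Dipole)
    then show ?thesis by blast
  next
    case (Momentum p0 h)
    have "orbit_equations c (h *\<^sub>R e1) 0 (p0 *\<^sub>R e1) 0"
      using assms e by (simp add: Momentum)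
    then show ?thesis by blast
  next
    case (Collinear \<sigma> p0 d0 h)
    have "orbit_equations c (h *\<^sub>R e1) ((\<sigma> * d0) *\<^sub>R e1) (p0 *\<^sub>R e1) 0"
      using assms e by (auto simp add: Collinear abs_mult)
    then show ?thesis by blast
  next
    case (Generic p0 d0 \<theta>)
    have "norm (cos \<theta> *\<^sub>R e1 + sin \<theta> *\<^sub>R e2) = 1"
      by (simp add: norm_eq_1 inner_add_left inner_add_right e power2_eq_square[symmetric])
    then have "orbit_equations c 0 (d0 *\<^sub>R (cos \<theta> *\<^sub>R e1 + sin \<theta> *\<^sub>R e2)) (p0 *\<^sub>R e1) 0"
      using assms e by (simp add: Generic inner_add_right)
    then show ?thesis by blast
  qed auto
  then show ?thesis by (auto simp: orbit_set_def)
qed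

lemma orbit_set_label_unique:
  assumes "admissible c" "admissible c'" "\<alpha> \<in> orbit_set E\<^sub>0 c" "\<alpha> \<in> orbit_set E\<^sub>0 c'"
  shows "c = c'"
proof -
  obtain j d p q E where \<alpha>: "\<alpha> = (j, d, p, q, E)" by (cases \<alpha>)
  have eq: "orbit_equations c j d p q" and eq': "orbit_equations c' j d p q"
    using assms(3,4) by (simp_all add: \<alpha>)
  \<comment> \<open>This separates \<open>Generic\<close> from \<open>Collinear\<close>; within
    \<open>Generic\<close>, injectivity of the cosine on the interval recovers the angle.\<close>
  have cos: "cos \<theta> \<noteq> 1" "cos \<theta> \<noteq> -1" if "0 < \<theta>" "\<theta> < pi" for \<theta> :: real
    using that cos_monotone_0_pi[of 0 \<theta>] cos_monotone_0_pi[of \<theta> pi] by auto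
  show ?thesis
    using assms(1,2) eq eq'
    by (cases c; cases c') (auto simp: spin_eq_0_iff dest: cos intro: cos_inj_pi)
qed

lemma ex_orbit_label:
  "\<exists>c. admissible c \<and> \<alpha> \<in> orbit_set (energy \<alpha>) c"
proof -
  obtain j d p q E where \<alpha>: "\<alpha> = (j, d, p, q, E)" by (cases \<alpha>)
  have "\<exists>c. admissible c \<and> orbit_equations c j d p q"
  proof (cases "q = 0")
    case False
    show ?thesis
    proof (cases "q *\<^sub>R j + p \<times> d = 0")
      case True
      then show ?thesis using False by (intro exI[of _ "Charged q"]) simp
    next
      case nz: False
      then have "norm (j + inverse q *\<^sub>R (p \<times> d)) > 0"
        using spin_eq_0_iff[OF False, of j "p \<times> d"] by simp
      then show ?thesis
        using False by (intro exI[of _ "Charged_Spin q (norm (j + inverse q *\<^sub>R (p \<times> d)))"]) simp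
    qed
  next
    case q: True
    consider "p = 0" "d = 0" "j = 0" | "p = 0" "d = 0" "j \<noteq> 0" | "p = 0" "d \<noteq> 0" | "p \<noteq> 0" "d = 0" | "p \<noteq> 0" "d \<noteq> 0"
      by blast
    then show ?thesis
    proof cases
      case 1
      then show ?thesis using q by (intro exI[of _ Vacuum]) simp
    next
      case 2
      then show ?thesis using q by (intro exI[of _ "Spin (norm j)"]) simp
    next
      case 3
      then show ?thesis using q by (intro exI[of _ "Dipole (norm d) (j \<bullet> d / norm d)"]) simp
    next
      case 4
      then show ?thesis using q by (intro exI[of _ "Momentum (norm p) (j \<bullet> p / norm p)"]) simp
    next
      case 5
      \<comment> \<open>The cosine of the angle between \<open>p\<close> and \<open>d\<close>: its
        extreme values give the sign of \<open>Collinear\<close>, all others give the angle of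
        \<open>Generic\<close>.\<close>
      define t where "t = p \<bullet> d / (norm p * norm d)"
      have t: "p \<bullet> d = norm p * norm d * t" using 5 by (simp add: t_def)
      have "\<bar>t\<bar> \<le> 1"
        using Cauchy_Schwarz_ineq2[of p d] 5 by (simp add: t_def abs_mult field_simps)
      then consider "t = 1 \<or> t = -1" | "-1 < t" "t < 1" by linarith
      then show ?thesis
      proof cases
        case 1
        then show ?thesis
          using 5 q t by (intro exI[of _ "Collinear t (norm p) (norm d) (j \<bullet> p / norm p)"]) simp
      next
        case 2
        then have "0 < arccos t" "arccos t < pi" "cos (arccos t) = t"
          using arccos_lt_bounded[of t] by auto
        then show ?thesis
          using 5 q t by (intro exI[of _ "Generic (norm p) (norm d) (arccos t)"]) simp
      qed
    qed
  qed
  then show ?thesis by (auto simp: \<alpha> energy_def)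
qed

section \<open>From labels to coadjoint orbits\<close>

lemma orbit_eq_orbit_set:
  assumes "admissible c" "\<alpha> \<in> orbit_set E\<^sub>0 c"
  shows "orbit dipole_group coadjoint \<alpha> = orbit_set E\<^sub>0 c"
proof
  show "orbit dipole_group coadjoint \<alpha> \<subseteq> orbit_set E\<^sub>0 c"
    using coadjoint_orbit_set[OF _ assms] by (auto simp: orbit_def)
  show "orbit_set E\<^sub>0 c \<subseteq> orbit dipole_group coadjoint \<alpha>"
    unfolding orbit_def using coadjoint_transitive[OF assms] by blast
qed

lemma orbit_set_in_coadjoint_orbits:
  assumes "admissible c"
  shows "orbit_set E\<^sub>0 c \<in> coadjoint_orbits"
proof -
  obtain \<alpha> where "\<alpha> \<in> orbit_set E\<^sub>0 c" using orbit_set_nonempty[OF assms] by blast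
  from orbit_eq_orbit_set[OF assms this, symmetric] show ?thesis
    unfolding orbits_def by blast
qed

lemma energy_orbit_set: "\<alpha> \<in> orbit_set E\<^sub>0 c \<Longrightarrow> energy \<alpha> = E\<^sub>0"
  by (auto simp: orbit_set_def energy_def)

lemma coadjoint_orbit_label:
  assumes "\<O> \<in> coadjoint_orbits"
  obtains E\<^sub>0 c where "admissible c" "\<O> = orbit_set E\<^sub>0 c"
proof -
  obtain \<alpha> where "\<O> = orbit dipole_group coadjoint \<alpha>"
    using assms by (auto simp: orbits_def)
  then show ?thesis using that ex_orbit_label[of \<alpha>] orbit_eq_orbit_set by blast
qed

theorem mainTheorem3:
  shows "(\<forall>\<O>\<in>coadjoint_orbits. \<forall>\<alpha>\<in>\<O>. \<forall>\<beta>\<in>\<O>. energy \<alpha> = energy \<beta>) \<and>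
    (\<forall>E\<^sub>0 :: real.
      (\<forall>\<O>\<in>coadjoint_orbits. \<O> \<subseteq> {\<alpha>. energy \<alpha> = E\<^sub>0} \<longrightarrow>
         (\<exists>!c. admissible c \<and> \<O> = orbit_set E\<^sub>0 c)) \<and>
      (\<forall>c. admissible c \<longrightarrow>
         orbit_set E\<^sub>0 c \<subseteq> {\<alpha>. energy \<alpha> = E\<^sub>0} \<and>
         orbit_set E\<^sub>0 c \<in> coadjoint_orbits \<and>
         embedded_submanifold (orbit_dim c) (orbit_set E\<^sub>0 c)))"
proof (intro conjI allI ballI impI)
  fix \<O> \<alpha> \<beta> assume "\<O> \<in> coadjoint_orbits" "\<alpha> \<in> \<O>" "\<beta> \<in> \<O>"
  then show "energy \<alpha> = energy \<beta>"
    using coadjoint_orbit_label energy_orbit_set by metis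
next
  fix E\<^sub>0 \<O> assume \<O>: "\<O> \<in> coadjoint_orbits" "\<O> \<subseteq> {\<alpha>. energy \<alpha> = E\<^sub>0}"
  then obtain E\<^sub>1 c where c: "admissible c" "\<O> = orbit_set E\<^sub>1 c"
    using coadjoint_orbit_label by metis
  \<comment> \<open>A common point forces \<open>E\<^sub>1 = E\<^sub>0\<close>, and also makes any
    two labels of the orbit equal.\<close>
  obtain \<alpha> where \<alpha>: "\<alpha> \<in> \<O>" using orbit_set_nonempty[OF c(1)] c(2) by blast
  then have "E\<^sub>1 = E\<^sub>0" using \<O>(2) c(2) energy_orbit_set by blast
  with c \<alpha> show "\<exists>!c. admissible c \<and> \<O> = orbit_set E\<^sub>0 c"
    using orbit_set_label_unique by blast
qed (auto simp: energy_orbit_set orbit_set_in_coadjoint_orbits embedded_submanifold_orbit_set)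

end
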